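(* Let $\mathsf{M}_2$ be the space of $2\times 2$ complex matrices and $\mathsf{M}_2^{sa}$ the real vector space of $2\times 2$ Hermitian matrices. A (real-)linear map $\Phi : \mathsf{M}_2^{sa} \to \mathsf{M}_2^{sa}$ is positivity-preserving if and only if there exist finite families $\{A_j\}, \{B_k\} \subset \mathsf{M}_2$ such that for all $\rho \in \mathsf{M}_2^{sa}$ $$\Phi(\rho) = \sum_j A_j \rho A_j^\dagger + \sum_k B_k \rho^T B_k^\dagger,$$ where $\rho^T$ denotes the transpose of $\rho$. Moreover, the total number of terms (the number of $A_j$'s plus the number of $B_k$'s) required in such a representation does not exceed $4$; that is, every positivity-preserving $\Phi$ admits such a representation with at most $4$ terms in total.
   Context: $A^\dagger$ denotes the conjugate transpose of $A$. A linear map $\Phi : \mathsf{M}_2^{sa} \to \mathsf{M}_2^{sa}$ is called positivity-preserving if it maps every positive semi-definite matrix to a positive semi-definite matrix. *)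

theory Defs
  imports "HOL-Analysis.Analysis"
begin

text \<open>Notions for square complex matrices of any size; \<open>complex^2^2\<close> is \<open>M\<^sub>2\<close>.\<close>

definition dagger :: "complex^'n^'m \<Rightarrow> complex^'m^'n" where
  "dagger A = (\<chi> i j. cnj (A $ j $ i))"

definition hermitian_matrices :: "(complex^'n^'n) set" where
  "hermitian_matrices = {A. dagger A = A}"

text \<open>For Hermitian \<open>A\<close> the sum below, \<open>v\<^sup>\<dagger> A v\<close>, is automatically real, so taking \<open>Re\<close> loses
  nothing.\<close>

definition positive_semidefinite :: "complex^'n^'n \<Rightarrow> bool" where
  "positive_semidefinite A \<longleftrightarrow>
     A \<in> hermitian_matrices \<and>
     (\<forall>v :: complex^'n. 0 \<le> Re (\<Sum>i\<in>UNIV. cnj (v $ i) * (A *v v) $ i))"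

text \<open>Maps on the real vector space of Hermitian matrices are functions on all matrices of which
  only the values on \<open>hermitian_matrices\<close> matter; \<open>*\<^sub>R\<close> is scaling by a real number.\<close>

definition linear_on_hermitian :: "(complex^'n^'n \<Rightarrow> complex^'n^'n) \<Rightarrow> bool" where
  "linear_on_hermitian \<Phi> \<longleftrightarrow>
     \<Phi> \<in> hermitian_matrices \<rightarrow> hermitian_matrices \<and>
     (\<forall>\<rho>\<in>hermitian_matrices. \<forall>\<sigma>\<in>hermitian_matrices. \<Phi> (\<rho> + \<sigma>) = \<Phi> \<rho> + \<Phi> \<sigma>) \<and>
     (\<forall>c::real. \<forall>\<rho>\<in>hermitian_matrices. \<Phi> (c *\<^sub>R \<rho>) = c *\<^sub>R \<Phi> \<rho>)"

definition positivity_preserving :: "(complex^'n^'n \<Rightarrow> complex^'n^'n) \<Rightarrow> bool" where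
  "positivity_preserving \<Phi> \<longleftrightarrow>
     (\<forall>\<rho>. positive_semidefinite \<rho> \<longrightarrow> positive_semidefinite (\<Phi> \<rho>))"

text \<open>The families are \<open>A 0, \<dots>, A (m - 1)\<close> and \<open>B 0, \<dots>, B (n - 1)\<close>; either may be empty, and
  repetitions are allowed.\<close>

definition represents ::
  "nat \<Rightarrow> (nat \<Rightarrow> complex^'n^'n) \<Rightarrow> nat \<Rightarrow> (nat \<Rightarrow> complex^'n^'n) \<Rightarrow>
     (complex^'n^'n \<Rightarrow> complex^'n^'n) \<Rightarrow> bool" where
  "represents m A n B \<Phi> \<longleftrightarrow>
     (\<forall>\<rho>\<in>hermitian_matrices.
        \<Phi> \<rho> = (\<Sum>j<m. A j ** \<rho> ** dagger (A j)) +
               (\<Sum>k<n. B k ** transpose \<rho> ** dagger (B k)))"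

end

theory Submission
  imports Defs
begin

text \<open>Write a Hermitian matrix as \<open>pauli t x = t + x \<cdot> \<sigma>\<close> with \<open>x\<close> in the Bloch space \<open>\<real>\<^sup>3\<close>; it is
  positive semidefinite iff \<open>\<bar>x\<bar> \<le> t\<close>. If \<open>det \<Phi>(A A\<^sup>\<dagger>)\<close> grows like \<open>\<bar>A\<bar>\<^sup>4\<close>, it has a minimum on
  \<open>det A = 1\<close>; composing \<open>\<Phi>\<close> with congruences on both sides moves the minimum to \<open>A = 1\<close> and makes
  \<open>\<Phi>\<close> unital, and then stationarity says that \<open>\<Phi>\<close> preserves the trace. So \<open>\<Phi>\<close> acts as
  \<open>pauli t x \<mapsto> pauli t (f x)\<close> with a linear contraction \<open>f\<close>. Reflections of \<open>\<real>\<^sup>3\<close> are implemented by maps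
  \<open>\<rho> \<mapsto> A \<rho>\<^sup>T A\<^sup>\<dagger>\<close>, so a singular value decomposition of \<open>f\<close> into reflections leaves a diagonal \<open>f\<close>
  with entries in \<open>[-1, 1]\<close>. A point of the cube \<open>[-1, 1]\<^sup>3\<close> is a convex combination of four vertices,
  and each vertex is a product of reflections. An arbitrary \<open>\<Phi>\<close> is the limit of
  \<open>\<Phi> + \<epsilon> tr(\<cdot>) 1\<close>, and sums of four terms are closed under limits by compactness.\<close>

subsection \<open>Conjugate transposes and congruences\<close>

lemma dagger_component: "dagger A $ i $ j = cnj (A $ j $ i)"
  by (simp add: dagger_def)

lemma dagger_add: "dagger (A + B) = dagger A + dagger B"
  by (simp add: vec_eq_iff dagger_component)

lemma dagger_scaleR: "dagger (c *\<^sub>R A) = c *\<^sub>R dagger A"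
  by (simp add: vec_eq_iff dagger_component)

lemma dagger_dagger [simp]: "dagger (dagger A) = A"
  by (simp add: vec_eq_iff dagger_component)

lemma dagger_zero [simp]: "dagger 0 = 0"
  by (simp add: vec_eq_iff dagger_component)

lemma dagger_mult: "dagger (A ** B) = dagger B ** dagger A"
  by (simp add: vec_eq_iff dagger_component matrix_matrix_mult_def mult.commute)

lemma dagger_mat_1 [simp]: "dagger (mat 1) = mat 1"
  by (simp add: vec_eq_iff dagger_component mat_def)

lemma dagger_transpose: "dagger (transpose A) = transpose (dagger A)"
  by (simp add: vec_eq_iff dagger_component transpose_def)

lemma transpose_add: "transpose (A + B) = transpose A + transpose B"
  by (simp add: vec_eq_iff transpose_def)

lemma matrix_mult_add_left: "((A :: complex^'n^'m) + B) ** C = A ** C + B ** C"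
  by (simp add: vec_eq_iff matrix_matrix_mult_def distrib_right sum.distrib)

definition congruence :: "complex^'n^'n \<Rightarrow> complex^'n^'n \<Rightarrow> complex^'n^'n" where
  "congruence A \<rho> = A ** \<rho> ** dagger A"

lemma linear_congruence: "linear (congruence A)"
  by (rule linearI)
     (simp_all add: congruence_def matrix_mult_add_left matrix_add_ldistrib
        scalar_matrix_assoc[symmetric] matrix_scalar_ac)

lemma congruence_mult: "congruence A (congruence B \<rho>) = congruence (A ** B) \<rho>"
  by (simp add: congruence_def dagger_mult matrix_mul_assoc)

lemma congruence_mat_1 [simp]: "congruence (mat 1) \<rho> = \<rho>"
  by (simp add: congruence_def)

lemma congruence_zero [simp]: "congruence 0 \<rho> = 0"
  by (simp add: congruence_def)

lemma transpose_congruence: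
  "transpose (congruence A \<rho>) = congruence (transpose (dagger A)) (transpose \<rho>)"
  by (simp add: congruence_def matrix_transpose_mul matrix_mul_assoc dagger_transpose)

lemma congruence_scaleR: "congruence (c *\<^sub>R A) \<rho> = c\<^sup>2 *\<^sub>R congruence A \<rho>"
  by (simp add: congruence_def dagger_scaleR scalar_matrix_assoc[symmetric] matrix_scalar_ac
      power2_eq_square)

lemma hermitian_congruence:
  "\<rho> \<in> hermitian_matrices \<Longrightarrow> congruence A \<rho> \<in> hermitian_matrices"
  by (simp add: hermitian_matrices_def congruence_def dagger_mult matrix_mul_assoc)

lemma hermitian_transpose:
  "\<rho> \<in> hermitian_matrices \<Longrightarrow> transpose \<rho> \<in> hermitian_matrices"
  by (simp add: hermitian_matrices_def dagger_transpose)

lemma hermitian_add: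
  "\<rho> \<in> hermitian_matrices \<Longrightarrow> \<sigma> \<in> hermitian_matrices \<Longrightarrow> \<rho> + \<sigma> \<in> hermitian_matrices"
  by (simp add: hermitian_matrices_def dagger_add)

lemma hermitian_scaleR:
  "\<rho> \<in> hermitian_matrices \<Longrightarrow> c *\<^sub>R \<rho> \<in> hermitian_matrices"
  by (simp add: hermitian_matrices_def dagger_scaleR)

lemma hermitian_mat_1: "mat 1 \<in> hermitian_matrices"
  by (simp add: hermitian_matrices_def)

section \<open>Positivity under congruence and transposition\<close>

lemma sesquilinear_dagger:
  "(\<Sum>i\<in>UNIV. cnj (v $ i) * (A *v w) $ i) = (\<Sum>j\<in>UNIV. cnj ((dagger A *v v) $ j) * w $ j)"
  by (simp add: matrix_vector_mult_def dagger_component sum_distrib_left sum_distrib_right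
      mult_ac) (rule sum.swap)

lemma psd_congruence:
  assumes "positive_semidefinite \<rho>"
  shows "positive_semidefinite (congruence A \<rho>)"
proof -
  have "(\<Sum>i\<in>UNIV. cnj (v $ i) * (congruence A \<rho> *v v) $ i)
      = (\<Sum>j\<in>UNIV. cnj ((dagger A *v v) $ j) * (\<rho> *v (dagger A *v v)) $ j)" for v
    by (simp only: congruence_def matrix_vector_mul_assoc[symmetric] sesquilinear_dagger[of v A])
  then show ?thesis
    using assms by (auto simp: positive_semidefinite_def hermitian_congruence)
qed

lemma psd_transpose:
  assumes "positive_semidefinite \<rho>"
  shows "positive_semidefinite (transpose \<rho>)"
proof -
  have "(\<Sum>i\<in>UNIV. cnj (v $ i) * (transpose \<rho> *v v) $ i)
      = (\<Sum>j\<in>UNIV. cnj ((\<chi> k. cnj (v $ k)) $ j) * (\<rho> *v (\<chi> k. cnj (v $ k))) $ j)" for v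
    by (simp add: matrix_vector_mult_def transpose_def sum_distrib_left mult_ac) (rule sum.swap)
  then show ?thesis
    using assms hermitian_transpose unfolding positive_semidefinite_def by metis
qed

lemma psd_zero: "positive_semidefinite 0"
  by (simp add: positive_semidefinite_def hermitian_matrices_def)

lemma psd_add:
  "positive_semidefinite \<rho> \<Longrightarrow> positive_semidefinite \<sigma> \<Longrightarrow> positive_semidefinite (\<rho> + \<sigma>)"
  by (simp add: positive_semidefinite_def hermitian_add matrix_vector_mult_add_rdistrib
      distrib_left sum.distrib)

lemma psd_sum:
  "(\<And>i. i \<in> I \<Longrightarrow> positive_semidefinite (f i)) \<Longrightarrow> positive_semidefinite (\<Sum>i\<in>I. f i)"
  by (induction I rule: infinite_finite_induct) (simp_all add: psd_zero psd_add)

text \<open>The easy direction of the theorem, for matrices of any size: every term of the sum is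
  positive.\<close>

lemma represents_imp_positivity_preserving:
  assumes "represents m A n B \<Phi>"
  shows "positivity_preserving \<Phi>"
  unfolding positivity_preserving_def
proof (intro allI impI)
  fix \<rho> :: "complex^'a^'a"
  assume "positive_semidefinite \<rho>"
  moreover from this have "\<Phi> \<rho> = (\<Sum>j<m. congruence (A j) \<rho>) + (\<Sum>k<n. congruence (B k) (transpose \<rho>))"
    using assms by (auto simp: represents_def congruence_def positive_semidefinite_def)
  ultimately show "positive_semidefinite (\<Phi> \<rho>)"
    by (simp add: psd_add psd_sum psd_congruence psd_transpose)
qed

subsection \<open>Bloch coordinates\<close>

definition pauli :: "real \<Rightarrow> real^3 \<Rightarrow> complex^2^2" where
  "pauli t x = vector [vector [Complex (t + x $ 3) 0, Complex (x $ 1) (- x $ 2)],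
                       vector [Complex (x $ 1) (x $ 2), Complex (t - x $ 3) 0]]"

lemma pauli_components [simp]:
  "pauli t x $ 1 $ 1 = Complex (t + x $ 3) 0"
  "pauli t x $ 1 $ 2 = Complex (x $ 1) (- x $ 2)"
  "pauli t x $ 2 $ 1 = Complex (x $ 1) (x $ 2)"
  "pauli t x $ 2 $ 2 = Complex (t - x $ 3) 0"
  by (simp_all add: pauli_def)

lemma matrix_eq_2: "(A :: 'a^2^2) = B \<longleftrightarrow>
    A $ 1 $ 1 = B $ 1 $ 1 \<and> A $ 1 $ 2 = B $ 1 $ 2 \<and> A $ 2 $ 1 = B $ 2 $ 1 \<and> A $ 2 $ 2 = B $ 2 $ 2"
  by (auto simp: vec_eq_iff forall_2)

lemma pauli_inject [simp]: "pauli t x = pauli s y \<longleftrightarrow> t = s \<and> x = y"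
  by (auto simp: matrix_eq_2 vec_eq_iff forall_3 complex_eq_iff)

lemma hermitian_pauli: "pauli t x \<in> hermitian_matrices"
  by (simp add: hermitian_matrices_def matrix_eq_2 dagger_component complex_eq_iff)

lemma hermitian_obtain_pauli:
  assumes "\<rho> \<in> hermitian_matrices"
  obtains t x where "\<rho> = pauli t x"
proof -
  have "cnj (\<rho> $ j $ i) = \<rho> $ i $ j" for i j
    using assms by (auto simp: hermitian_matrices_def vec_eq_iff dagger_component)
  from this[of 1 1] this[of 2 2] this[of 1 2]
  have "\<rho> = pauli ((Re (\<rho> $ 1 $ 1) + Re (\<rho> $ 2 $ 2)) / 2)
      (vector [Re (\<rho> $ 1 $ 2), - Im (\<rho> $ 1 $ 2), (Re (\<rho> $ 1 $ 1) - Re (\<rho> $ 2 $ 2)) / 2])"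
    by (auto simp: matrix_eq_2 complex_eq_iff field_simps)
  then show ?thesis by (rule that)
qed

lemma pauli_add: "pauli t x + pauli s y = pauli (t + s) (x + y)"
  by (simp add: matrix_eq_2 complex_eq_iff)

lemma pauli_scaleR: "c *\<^sub>R pauli t x = pauli (c * t) (c *\<^sub>R x)"
  by (simp add: matrix_eq_2 complex_eq_iff algebra_simps)

lemma mat_1_eq_pauli: "mat 1 = pauli 1 0"
  by (simp add: matrix_eq_2 complex_eq_iff mat_def)

lemma inner_3: "(x :: real^3) \<bullet> y = x $ 1 * y $ 1 + x $ 2 * y $ 2 + x $ 3 * y $ 3"
  by (simp add: inner_vec_def sum_3)

lemma det_pauli: "det (pauli t x) = of_real (t\<^sup>2 - x \<bullet> x)"
  by (simp add: det_2 complex_eq_iff inner_3 power2_eq_square algebra_simps)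

text \<open>The factor is Hermitian, so this is the square of \<open>t + X\<close> with
  \<open>X = pauli 0 x\<close>, where \<open>X ** X\<close> is \<open>x \<bullet> x\<close> times
  the identity. It supplies the test matrices for the variation around the minimum.\<close>

lemma pauli_square: "congruence (pauli t x) (mat 1) = pauli (t\<^sup>2 + x \<bullet> x) ((2 * t) *\<^sub>R x)"
  by (simp add: congruence_def mat_1_eq_pauli matrix_eq_2 matrix_matrix_mult_def sum_2 dagger_component
      complex_eq_iff inner_3 power2_eq_square algebra_simps)

lemma quadratic_form_pauli:
  "(\<Sum>i\<in>UNIV. cnj (v $ i) * (pauli t x *v v) $ i) =
   of_real ((t + x $ 3) * (cmod (v $ 1))\<^sup>2 + (t - x $ 3) * (cmod (v $ 2))\<^sup>2
     + 2 * Re (cnj (v $ 1) * Complex (x $ 1) (- x $ 2) * v $ 2))"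
  unfolding cmod_power2
  by (simp add: matrix_vector_mult_def sum_2 complex_eq_iff power2_eq_square algebra_simps)

subsection \<open>Singular values by reflections\<close>

text \<open>The normal \<open>n\<close> need not be a unit vector, and \<open>n = 0\<close> gives
  the identity, so \<open>reflection (u - v)\<close> makes sense for \<open>u = v\<close> as
  well.\<close>

definition reflection :: "'a::real_inner \<Rightarrow> 'a \<Rightarrow> 'a" where
  "reflection n x = x - (2 * (x \<bullet> n) / (n \<bullet> n)) *\<^sub>R n"

lemma reflection_0 [simp]: "reflection 0 x = x"
  by (simp add: reflection_def)

lemma linear_reflection: "linear (reflection n)"
  by (rule linearI)
     (simp_all add: reflection_def algebra_simps add_divide_distrib)

lemma reflection_symmetric: "reflection n x \<bullet> y = x \<bullet> reflection n y"
  by (simp add: reflection_def inner_diff_left inner_diff_right inner_commute)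

lemma reflection_involution [simp]: "reflection n (reflection n x) = x"
  by (cases "n = 0") (simp_all add: reflection_def inner_diff_left)

lemma norm_reflection [simp]: "norm (reflection n x) = norm x"
  by (simp add: norm_eq_sqrt_inner reflection_symmetric)

lemma reflection_orthogonal: "x \<bullet> n = 0 \<Longrightarrow> reflection n x = x"
  by (simp add: reflection_def)

text \<open>For equal norms the mirror is the perpendicular bisector of \<open>u\<close> and
  \<open>v\<close>: the square of the norm of \<open>u - v\<close> is
  \<open>2 * (u \<bullet> (u - v))\<close>, which makes the coefficient in \<open>reflection\<close>
  equal to 1.\<close>

lemma reflection_swap:
  assumes "norm u = norm v"
  shows "reflection (u - v) u = v"
proof (cases "u = v")
  case False
  have "u \<bullet> u = v \<bullet> v"
    using assms by (simp add: norm_eq_sqrt_inner)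
  then have "(u - v) \<bullet> (u - v) = 2 * (u \<bullet> (u - v))"
    by (simp add: inner_diff_left inner_diff_right inner_commute)
  moreover have "(u - v) \<bullet> (u - v) \<noteq> 0"
    using False by simp
  ultimately show ?thesis
    by (simp add: reflection_def)
qed simp

lemma reflection_swap':
  assumes "norm u = norm v"
  shows "reflection (u - v) v = u"
  using reflection_swap[OF assms] reflection_involution by metis

text \<open>The first-order condition at an extremum: a linear term bounded by a quadratic one for
  both signs of \<epsilon> vanishes.\<close>

lemma quadratic_bound_imp_zero:
  fixes a K :: real
  assumes "\<And>\<epsilon>. \<epsilon> * a \<le> \<epsilon>\<^sup>2 * K"
  shows "a = 0"
proof (rule ccontr)
  assume "a \<noteq> 0"
  \<comment> \<open>Chosen so that \<open>\<delta> * K < 1\<close>; the hypothesis at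
    \<open>\<delta> * a\<close> then fails unless \<open>a = 0\<close>.\<close>
  define \<delta> where "\<delta> = 1 / (1 + \<bar>K\<bar>)"
  have \<delta>: "\<delta> > 0" "\<delta> * \<bar>K\<bar> < 1"
    by (simp_all add: \<delta>_def)
  have "\<delta> * K \<le> \<delta> * \<bar>K\<bar>"
    using \<delta> by (intro mult_left_mono) auto
  then have "\<delta> * K < 1"
    using \<delta> by linarith
  then have "(\<delta> * a\<^sup>2) * (\<delta> * K) < (\<delta> * a\<^sup>2) * 1"
    using \<delta> \<open>a \<noteq> 0\<close> by (intro mult_strict_left_mono) auto
  moreover have "(\<delta> * a) * a \<le> (\<delta> * a)\<^sup>2 * K"
    by (rule assms)
  ultimately show False
    by (simp add: power2_eq_square mult_ac)
qed

lemma norm_add_squared: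
  "(norm (x + y :: 'a::real_inner))\<^sup>2 = (norm x)\<^sup>2 + 2 * (x \<bullet> y) + (norm y)\<^sup>2"
  by (simp add: power2_norm_eq_inner inner_add_left inner_add_right inner_commute)

text \<open>Take \<open>u\<close> maximising \<open>norm (f u)\<close> on the unit sphere of
  \<open>V\<close>, with maximum \<open>s\<close>, and let \<open>v\<close> be the direction of
  \<open>f u\<close>. Varying \<open>u\<close> along some \<open>y\<close> orthogonal to it shows
  that \<open>f y\<close> is orthogonal to \<open>v\<close>.\<close>

lemma singular_value_step:
  fixes f :: "'a::euclidean_space \<Rightarrow> 'a"
  assumes "linear f" and V: "subspace V" "V \<noteq> {0}" and fV: "\<And>x. x \<in> V \<Longrightarrow> f x \<in> V"
  obtains u v s where "u \<in> V" "v \<in> V" "norm u = 1" "norm v = 1" "f u = s *\<^sub>R v"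
    "\<And>y. y \<in> V \<Longrightarrow> y \<bullet> u = 0 \<Longrightarrow> f y \<bullet> v = 0"
proof -
  obtain w where w: "w \<in> V" "w \<noteq> 0"
    using V subspace_0 by blast
  let ?K = "V \<inter> sphere 0 1"
  have "sgn w \<in> ?K"
    using w V by (simp add: sgn_div_norm subspace_scale)
  then have "?K \<noteq> {}"
    by blast
  moreover have "compact ?K"
    by (intro closed_Int_compact closed_subspace V compact_sphere)
  moreover have "continuous_on ?K (\<lambda>x. norm (f x))"
    using \<open>linear f\<close> by (intro continuous_on_norm linear_continuous_on) (simp add: linear_conv_bounded_linear)
  ultimately obtain u where u: "u \<in> ?K" "\<And>x. x \<in> ?K \<Longrightarrow> norm (f x) \<le> norm (f u)"
    using continuous_attains_sup[of ?K "\<lambda>x. norm (f x)"] by blast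
  define s where "s = norm (f u)"
  have bound: "norm (f y) \<le> s * norm y" if "y \<in> V" for y
  proof (cases "y = 0")
    case False
    then have "sgn y \<in> ?K"
      using that V by (simp add: sgn_div_norm subspace_scale)
    then have "norm (f (sgn y)) \<le> s"
      using u s_def by blast
    then show ?thesis
      using False by (simp add: sgn_div_norm linear_cmul[OF \<open>linear f\<close>] field_simps)
  qed (simp add: linear_0[OF \<open>linear f\<close>])
  \<comment> \<open>If \<open>s = 0\<close>, then \<open>f\<close> vanishes on \<open>V\<close> and
    any unit vector of \<open>V\<close> would do.\<close>
  define v where "v = (if s = 0 then u else f u /\<^sub>R s)"
  have v: "v \<in> V" "norm v = 1" "f u = s *\<^sub>R v"
    using u fV V by (auto simp: v_def s_def subspace_scale)
  have "f y \<bullet> v = 0" if y: "y \<in> V" "y \<bullet> u = 0" for y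
  proof (cases "s = 0")
    case True
    then show ?thesis
      using bound[OF y(1)] by simp
  next
    case False
    \<comment> \<open>Expand both sides of \<open>norm (f (u + \<epsilon> *\<^sub>R y)) \<le> s *
      norm (u + \<epsilon> *\<^sub>R y)\<close> after squaring: the constant terms agree, and the
      linear term on the right vanishes because \<open>y\<close> is orthogonal to
      \<open>u\<close>.\<close>
    have "\<epsilon> * (2 * s * (f y \<bullet> v)) \<le> \<epsilon>\<^sup>2 * (s\<^sup>2 * (norm y)\<^sup>2)" for \<epsilon>
    proof -
      have "u + \<epsilon> *\<^sub>R y \<in> V"
        using u y V by (auto intro: subspace_add subspace_scale)
      then have "(norm (f (u + \<epsilon> *\<^sub>R y)))\<^sup>2 \<le> (s * norm (u + \<epsilon> *\<^sub>R y))\<^sup>2"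
        by (intro power_mono bound) auto
      moreover have "f (u + \<epsilon> *\<^sub>R y) = s *\<^sub>R v + \<epsilon> *\<^sub>R f y"
        by (simp add: linear_add[OF \<open>linear f\<close>] linear_cmul[OF \<open>linear f\<close>] v)
      then have "(norm (f (u + \<epsilon> *\<^sub>R y)))\<^sup>2 = s\<^sup>2 + \<epsilon> * (2 * s * (f y \<bullet> v)) + \<epsilon>\<^sup>2 * (norm (f y))\<^sup>2"
        using v(2) by (simp add: norm_add_squared power_mult_distrib inner_commute)
      moreover have "(s * norm (u + \<epsilon> *\<^sub>R y))\<^sup>2 = s\<^sup>2 + \<epsilon>\<^sup>2 * (s\<^sup>2 * (norm y)\<^sup>2)"
        using u y(2) by (simp add: norm_add_squared power_mult_distrib inner_commute algebra_simps)
      ultimately show ?thesis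
        using zero_le_power2[of "\<epsilon> * norm (f y)"] unfolding power_mult_distrib by linarith
    qed
    then have "2 * s * (f y \<bullet> v) = 0"
      by (rule quadratic_bound_imp_zero)
    then show ?thesis
      using False by simp
  qed
  then show ?thesis
    using that u v by auto
qed

text \<open>The singular value decomposition as an induction rule: the orthogonal factors are built
  as products of reflections, so closure of \<open>P\<close> under one reflection at a time on
  either side suffices.\<close>

lemma singular_value_induct:
  fixes f :: "'a::euclidean_space \<Rightarrow> 'a"
  assumes diagonal: "\<And>s. (\<And>b. b \<in> Basis \<Longrightarrow> \<bar>s b\<bar> \<le> 1) \<Longrightarrow>
      P (\<lambda>x. \<Sum>b\<in>Basis. (s b * (x \<bullet> b)) *\<^sub>R b)"
    and left: "\<And>f n. P f \<Longrightarrow> P (\<lambda>x. reflection n (f x))"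
    and right: "\<And>f n. P f \<Longrightarrow> P (\<lambda>x. f (reflection n x))"
    and "linear f" "\<And>x. norm (f x) \<le> norm x"
  shows "P f"
proof -
  \<comment> \<open>\<open>S\<close> collects the basis vectors already split off: \<open>f\<close>
    and its adjoint both send each \<open>b\<close> in \<open>S\<close> to
    \<open>c b *\<^sub>R b\<close>. The induction is on the number of remaining basis
    vectors.\<close>
  have "P f" if "S \<subseteq> Basis" "linear f" "\<And>x. norm (f x) \<le> norm x"
    "\<And>b. b \<in> S \<Longrightarrow> f b = c b *\<^sub>R b" "\<And>b x. b \<in> S \<Longrightarrow> f x \<bullet> b = c b * (x \<bullet> b)" for S c f
    using that
  proof (induction "card (Basis - S)" arbitrary: S c f)
    case 0
    then have S: "S = Basis"
      by auto
    have "\<bar>c b\<bar> \<le> 1" if "b \<in> Basis" for b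
      using "0.prems"(3)[of b] "0.prems"(4)[of b] that S by simp
    moreover have "f = (\<lambda>x. \<Sum>b\<in>Basis. (c b * (x \<bullet> b)) *\<^sub>R b)"
    proof
      fix x
      have "f x = (\<Sum>b\<in>Basis. (f x \<bullet> b) *\<^sub>R b)"
        by (simp add: euclidean_representation)
      then show "f x = (\<Sum>b\<in>Basis. (c b * (x \<bullet> b)) *\<^sub>R b)"
        using "0.prems"(5) S by simp
    qed
    ultimately show ?case
      using diagonal[of c] by simp
  next
    case (Suc k)
    note lin = Suc.prems(2) and diag = Suc.prems(4,5)
    from Suc.hyps(2) obtain e where e: "e \<in> Basis" "e \<notin> S"
      by (metis Diff_eq_empty_iff card.empty subsetI nat.distinct(1))
    \<comment> \<open>The orthogonal complement of \<open>S\<close>; it is invariant under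
      \<open>f\<close> by the adjoint half of the condition on \<open>S\<close>.\<close>
    define V where "V = {x. \<forall>b\<in>S. x \<bullet> b = 0}"
    have V: "subspace V"
      by (auto simp: V_def subspace_def inner_add_left)
    have eV: "e \<in> V"
      using e Suc.prems(1) by (auto simp: V_def inner_Basis)
    moreover have "f x \<in> V" if "x \<in> V" for x
      using that diag by (auto simp: V_def)
    ultimately obtain u v s where uv: "u \<in> V" "v \<in> V" "norm u = 1" "norm v = 1" "f u = s *\<^sub>R v"
      and orth: "\<And>y. y \<in> V \<Longrightarrow> y \<bullet> u = 0 \<Longrightarrow> f y \<bullet> v = 0"
      using singular_value_step[OF lin V] e by (metis nonzero_Basis singletonD)
    \<comment> \<open>The adjoint of \<open>f\<close> sends \<open>v\<close> to
      \<open>s *\<^sub>R u\<close>. Split \<open>x\<close> into its part \<open>z\<close> in the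
      span of \<open>S\<close>, its component along \<open>u\<close>, and a rest \<open>y\<close> in
      \<open>V\<close> orthogonal to \<open>u\<close>; neither \<open>f z\<close> nor
      \<open>f y\<close> has a component along \<open>v\<close>.\<close>
    have adj: "f x \<bullet> v = s * (x \<bullet> u)" for x
    proof -
      define z where "z = (\<Sum>b\<in>S. (x \<bullet> b) *\<^sub>R b)"
      define y where "y = x - z - (x \<bullet> u) *\<^sub>R u"
      have fin: "finite S"
        using Suc.prems(1) finite_subset finite_Basis by blast
      have zb: "z \<bullet> b = x \<bullet> b" if "b \<in> S" for b
      proof -
        have "z \<bullet> b = (\<Sum>a\<in>S. if a = b then x \<bullet> b else 0)"
          unfolding z_def inner_sum_left
          using Suc.prems(1) that by (intro sum.cong) (auto simp: inner_Basis subset_iff)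
        then show ?thesis
          using that fin by simp
      qed
      have zu: "z \<bullet> u = 0"
        using uv(1) by (simp add: z_def inner_sum_left inner_sum_right V_def inner_commute)
      have "f z = (\<Sum>b\<in>S. (x \<bullet> b) *\<^sub>R (c b *\<^sub>R b))"
        unfolding z_def linear_sum[OF lin] using diag(1) by (intro sum.cong) (simp_all add: linear_cmul[OF lin])
      then have fz: "f z \<bullet> v = 0"
        using uv(2) by (simp add: inner_sum_left inner_sum_right V_def inner_commute)
      have "y \<in> V"
        using zb uv(1) by (simp add: y_def V_def inner_diff_left)
      moreover have "y \<bullet> u = 0"
        using zu uv(3) by (simp add: y_def inner_diff_left flip: power2_norm_eq_inner)
      ultimately have "f y \<bullet> v = 0"
        by (rule orth)
      moreover have "f x = f y + f z + (x \<bullet> u) *\<^sub>R f u"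
        by (simp add: y_def linear_diff[OF lin] linear_cmul[OF lin])
      ultimately show ?thesis
        using fz uv by (simp add: inner_add_left flip: power2_norm_eq_inner)
    qed
    \<comment> \<open>\<open>Q\<close> exchanges \<open>u\<close> with \<open>e\<close> and
      \<open>R\<close> exchanges \<open>v\<close> with \<open>e\<close>. Both fix \<open>S\<close>
      pointwise, since \<open>u\<close>, \<open>v\<close> and \<open>e\<close> lie in
      \<open>V\<close>. Hence \<open>R \<circ> f \<circ> Q\<close> is diagonal on \<open>e\<close>
      too, and since \<open>Q\<close> and \<open>R\<close> are involutions, \<open>f\<close> is
      recovered from it by the same two reflections.\<close>
    define Q where "Q = reflection (u - e)"
    define R where "R = reflection (v - e)"
    have ue: "norm u = norm e" "norm v = norm e"
      using uv e by simp_all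
    have QR: "Q u = e" "Q e = u" "R v = e" "R e = v" "linear Q" "linear R"
      using ue unfolding Q_def R_def by (simp_all add: reflection_swap reflection_swap' linear_reflection)
    have sym: "Q x \<bullet> y = x \<bullet> Q y" "R x \<bullet> y = x \<bullet> R y" for x y
      by (simp_all add: Q_def R_def reflection_symmetric)
    have fix_S: "Q b = b" "R b = b" if "b \<in> S" for b
      using that uv eV
      by (auto simp: Q_def R_def V_def inner_diff_right inner_commute intro!: reflection_orthogonal)
    define g where "g = (\<lambda>x. R (f (Q x)))"
    define c' where "c' = c(e := s)"
    have "k = card (Basis - insert e S)"
    proof -
      have "Basis - insert e S = (Basis - S) - {e}"
        by blast
      moreover have "card ((Basis - S) - {e}) = card (Basis - S) - 1"
        using e by (intro card_Diff_singleton) simp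
      ultimately show ?thesis
        using Suc.hyps(2) by simp
    qed
    then have "P g"
    proof (rule Suc.hyps(1)[where c = c'])
      show "insert e S \<subseteq> Basis"
        using e Suc.prems(1) by simp
      show "linear g"
        using linear_compose[OF linear_compose[OF QR(5) lin] QR(6)] by (simp add: g_def o_def)
      show "norm (g x) \<le> norm x" for x
        using Suc.prems(3)[of "Q x"] by (simp add: g_def Q_def R_def)
      show "g b = c' b *\<^sub>R b" if "b \<in> insert e S" for b
        using that e diag(1)[of b] uv(5) by (auto simp: g_def c'_def QR fix_S linear_cmul[OF QR(6)])
      show "g x \<bullet> b = c' b * (x \<bullet> b)" if "b \<in> insert e S" for b x
        using that e diag(2)[of b] by (auto simp: g_def c'_def QR fix_S sym adj)
    qed
    then have "P (\<lambda>x. R (g (Q x)))"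
      unfolding Q_def R_def by (intro left right)
    then show ?case
      by (simp add: g_def Q_def R_def)
  qed
  from this[of "{}" f] show ?thesis
    using assms by simp
qed

subsection \<open>Sums of four elementary maps\<close>

text \<open>One term of either kind, encoded as a pair of matrices of which one is zero. This
  condition on pairs is closed, so it survives the limit in
  \<open>decomposable_limit\<close>.\<close>

definition elementary :: "(complex^'n^'n \<Rightarrow> complex^'n^'n) \<Rightarrow> bool" where
  "elementary T \<longleftrightarrow> (\<exists>A B. (A = 0 \<or> B = 0) \<and>
     T = (\<lambda>\<rho>. congruence A \<rho> + congruence B (transpose \<rho>)))"

lemma elementary_congruence: "elementary (congruence A)"
  unfolding elementary_def by (rule exI[of _ A], rule exI[of _ 0]) simp

lemma elementary_congruence_transpose: "elementary (\<lambda>\<rho>. congruence A (transpose \<rho>))"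
  unfolding elementary_def by (rule exI[of _ 0], rule exI[of _ A]) simp

lemma elementary_cases:
  assumes "elementary T"
  obtains A where "T = congruence A" | A where "T = (\<lambda>\<rho>. congruence A (transpose \<rho>))"
proof -
  obtain A B where "A = 0 \<or> B = 0" "T = (\<lambda>\<rho>. congruence A \<rho> + congruence B (transpose \<rho>))"
    using assms unfolding elementary_def by blast
  then have "T = congruence A \<or> T = (\<lambda>\<rho>. congruence B (transpose \<rho>))"
    by (elim disjE) simp_all
  then show ?thesis
    using that by blast
qed

text \<open>A transposition moves past a congruence by conjugating the entries of its matrix, and
  two transpositions cancel.\<close>

lemma elementary_compose:
  assumes "elementary S" "elementary T"
  shows "elementary (\<lambda>\<rho>. S (T \<rho>))"
  by (rule elementary_cases[OF assms(1)]; rule elementary_cases[OF assms(2)])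
     (simp_all add: congruence_mult transpose_congruence elementary_congruence
       elementary_congruence_transpose)

lemma elementary_scaleR:
  assumes "elementary T" "0 \<le> c"
  shows "elementary (\<lambda>\<rho>. c *\<^sub>R T \<rho>)"
proof -
  have "c *\<^sub>R T \<rho> = congruence (sqrt c *\<^sub>R mat 1) (T \<rho>)" for \<rho>
    using assms(2) by (simp add: congruence_scaleR)
  then show ?thesis
    using elementary_compose[OF elementary_congruence assms(1)] by simp
qed

lemma elementary_id: "elementary (\<lambda>\<rho>. \<rho>)"
proof -
  have "congruence (mat 1) = (\<lambda>\<rho> :: complex^'a^'a. \<rho>)"
    by (simp add: fun_eq_iff)
  then show ?thesis
    using elementary_congruence by metis
qed

lemma linear_elementary:
  assumes "elementary T"
  shows "linear T"
proof -
  have lin: "linear (\<lambda>\<rho>. congruence A (transpose \<rho>))" for A :: "complex^'a^'a"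
    by (rule linearI) (simp_all add: transpose_add transpose_scalar linear_add[OF linear_congruence]
        linear_cmul[OF linear_congruence])
  show ?thesis
    by (rule elementary_cases[OF assms]) (simp_all add: linear_congruence lin)
qed

lemma elementary_hermitian:
  assumes "elementary T" "\<rho> \<in> hermitian_matrices"
  shows "T \<rho> \<in> hermitian_matrices"
  by (rule elementary_cases[OF assms(1)])
     (simp_all add: assms(2) hermitian_congruence hermitian_transpose)

text \<open>Exactly four terms stand for at most four, because the zero map is elementary. Indexing
  by the type \<open>4\<close> makes the families points of a finite-dimensional space, as the
  compactness argument requires.\<close>

definition decomposable :: "(complex^'n^'n \<Rightarrow> complex^'n^'n) \<Rightarrow> bool" where
  "decomposable \<Phi> \<longleftrightarrow> (\<exists>T :: 4 \<Rightarrow> complex^'n^'n \<Rightarrow> complex^'n^'n.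
     (\<forall>i. elementary (T i)) \<and> (\<forall>\<rho>\<in>hermitian_matrices. \<Phi> \<rho> = (\<Sum>i\<in>UNIV. T i \<rho>)))"

lemma decomposable_cong:
  assumes "\<And>\<rho>. \<rho> \<in> hermitian_matrices \<Longrightarrow> \<Phi> \<rho> = \<Psi> \<rho>"
  shows "decomposable \<Phi> \<longleftrightarrow> decomposable \<Psi>"
  using assms unfolding decomposable_def by auto

lemma decomposable_elementary_left:
  assumes "decomposable \<Phi>" "elementary S"
  shows "decomposable (\<lambda>\<rho>. S (\<Phi> \<rho>))"
proof -
  obtain T :: "4 \<Rightarrow> _" where T: "\<forall>i. elementary (T i)"
    "\<forall>\<rho>\<in>hermitian_matrices. \<Phi> \<rho> = (\<Sum>i\<in>UNIV. T i \<rho>)"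
    using assms(1) unfolding decomposable_def by blast
  show ?thesis
    unfolding decomposable_def
    using T assms(2)
    by (intro exI[of _ "\<lambda>i \<rho>. S (T i \<rho>)"])
       (simp add: elementary_compose linear_sum[OF linear_elementary[OF assms(2)]])
qed

lemma decomposable_elementary_right:
  assumes "decomposable \<Phi>" "elementary S"
  shows "decomposable (\<lambda>\<rho>. \<Phi> (S \<rho>))"
proof -
  obtain T :: "4 \<Rightarrow> _" where T: "\<forall>i. elementary (T i)"
    "\<forall>\<rho>\<in>hermitian_matrices. \<Phi> \<rho> = (\<Sum>i\<in>UNIV. T i \<rho>)"
    using assms(1) unfolding decomposable_def by blast
  show ?thesis
    unfolding decomposable_def
    using T assms(2)
    by (intro exI[of _ "\<lambda>i \<rho>. T i (S \<rho>)"]) (simp add: elementary_compose elementary_hermitian)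
qed


text \<open>The terms are sorted by kind one at a time: a new matrix is stored at index
  \<open>m\<close> or \<open>n\<close>, the first index outside the sums formed so far.\<close>

lemma represents_card:
  assumes "finite I" "\<And>i. i \<in> I \<Longrightarrow> elementary (T i)"
  shows "\<exists>m A n B. represents m A n B (\<lambda>\<rho>. \<Sum>i\<in>I. T i \<rho>) \<and> m + n = card I"
  using assms
proof (induction I)
  case empty
  show ?case
    by (intro exI[of _ 0] exI[of _ "\<lambda>_. 0"]) (simp add: represents_def)
next
  case (insert i I)
  then obtain m A n B where rep: "represents m A n B (\<lambda>\<rho>. \<Sum>i\<in>I. T i \<rho>)" "m + n = card I"
    by blast
  have "elementary (T i)"
    using insert by blast
  then show ?case
  proof (cases rule: elementary_cases)
    case (1 C)
    then have "represents (Suc m) (A(m := C)) n B (\<lambda>\<rho>. \<Sum>i\<in>insert i I. T i \<rho>)"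
      using rep insert by (simp add: represents_def congruence_def add_ac)
    then show ?thesis
      using rep insert by (metis add_Suc card_insert_disjoint)
  next
    case (2 C)
    then have "represents m A (Suc n) (B(n := C)) (\<lambda>\<rho>. \<Sum>i\<in>insert i I. T i \<rho>)"
      using rep insert by (simp add: represents_def congruence_def add_ac)
    then show ?thesis
      using rep insert by (metis add_Suc_right card_insert_disjoint)
  qed
qed

lemma decomposable_imp_represents:
  assumes "decomposable \<Phi>"
  shows "\<exists>m A n B. represents m A n B \<Phi> \<and> m + n \<le> 4"
proof -
  obtain T :: "4 \<Rightarrow> _" where T: "\<forall>i. elementary (T i)"
    "\<forall>\<rho>\<in>hermitian_matrices. \<Phi> \<rho> = (\<Sum>i\<in>UNIV. T i \<rho>)"
    using assms unfolding decomposable_def by blast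
  obtain m A n B where rep: "represents m A n B (\<lambda>\<rho>. \<Sum>i\<in>UNIV. T i \<rho>)"
    "m + n = card (UNIV :: 4 set)"
    using represents_card[of "UNIV :: 4 set" T] T(1) by auto
  have "represents m A n B \<Phi>"
    using rep(1) T(2) by (simp add: represents_def)
  moreover have "m + n \<le> 4"
    using rep(2) by simp
  ultimately show ?thesis
    by blast
qed

section \<open>Reflections of the Bloch space as elementary maps\<close>

text \<open>Congruence with the symplectic form after transposition is \<open>pauli t x \<mapsto> pauli t (- x)\<close>, and
  \<open>N X N = 2 (x \<bullet> n) N - (n \<bullet> n) X\<close> for \<open>X = pauli 0 x\<close> and \<open>N = pauli 0 n\<close>.\<close>

lemma reflection_elementary:
  "\<exists>E. elementary E \<and> (\<forall>t x. E (pauli t x) = pauli t (reflection n x))"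
proof (cases "n = 0")
  case True
  then show ?thesis
    using elementary_id by (intro exI[of _ "\<lambda>\<rho>. \<rho>"]) simp
next
  case False
  define J :: "complex^2^2" where "J = vector [vector [0, 1], vector [-1, 0]]"
  have J: "J $ 1 $ 1 = 0" "J $ 1 $ 2 = 1" "J $ 2 $ 1 = -1" "J $ 2 $ 2 = 0"
    by (simp_all add: J_def)
  have flip: "congruence J (transpose (pauli t x)) = pauli t (- x)" for t x
    by (simp add: congruence_def matrix_eq_2 matrix_matrix_mult_def sum_2 J dagger_component
        transpose_def complex_eq_iff)
  have "congruence (pauli 0 n) (pauli t (- x))
      = pauli ((n \<bullet> n) * t) ((n \<bullet> n) *\<^sub>R x - (2 * (x \<bullet> n)) *\<^sub>R n)" for t x
    by (simp add: congruence_def matrix_eq_2 matrix_matrix_mult_def sum_2 dagger_component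
        complex_eq_iff inner_3 algebra_simps)
  then have "(1 / (n \<bullet> n)) *\<^sub>R congruence (pauli 0 n) (congruence J (transpose (pauli t x)))
      = pauli t (reflection n x)" for t x
    using False by (simp add: flip pauli_scaleR reflection_def scaleR_diff_right)
  moreover have "elementary (\<lambda>\<rho>. (1 / (n \<bullet> n)) *\<^sub>R congruence (pauli 0 n) (congruence J (transpose \<rho>)))"
    by (intro elementary_scaleR elementary_compose[OF elementary_congruence]
        elementary_congruence_transpose) simp
  ultimately show ?thesis
    by blast
qed

subsection \<open>Maps induced by contractions of the Bloch space\<close>

definition bloch_vector :: "complex^2^2 \<Rightarrow> real^3" where
  "bloch_vector \<rho> = vector [Re (\<rho> $ 2 $ 1), Im (\<rho> $ 2 $ 1), Re (\<rho> $ 1 $ 1 - \<rho> $ 2 $ 2) / 2]"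

lemma bloch_vector_pauli [simp]: "bloch_vector (pauli t x) = x"
  by (simp add: bloch_vector_def vec_eq_iff forall_3)

lemma trace_pauli [simp]: "trace (pauli t x) = of_real (2 * t)"
  by (simp add: trace_def sum_2 complex_eq_iff)

definition bloch :: "(real^3 \<Rightarrow> real^3) \<Rightarrow> complex^2^2 \<Rightarrow> complex^2^2" where
  "bloch f \<rho> = pauli (Re (trace \<rho>) / 2) (f (bloch_vector \<rho>))"

lemma bloch_pauli [simp]: "bloch f (pauli t x) = pauli t (f x)"
  by (simp add: bloch_def)

text \<open>This and its counterpart on the right are the closure hypotheses of
  \<open>singular_value_induct\<close>. Composing each term with an elementary map keeps the number
  of terms.\<close>

lemma decomposable_bloch_reflection_left:
  assumes "decomposable (bloch f)"
  shows "decomposable (bloch (\<lambda>x. reflection n (f x)))"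
proof -
  obtain E where E: "elementary E" "\<And>t x. E (pauli t x) = pauli t (reflection n x)"
    using reflection_elementary by blast
  have "bloch (\<lambda>x. reflection n (f x)) \<rho> = E (bloch f \<rho>)" if "\<rho> \<in> hermitian_matrices" for \<rho>
    using that E by (elim hermitian_obtain_pauli) simp
  then show ?thesis
    using decomposable_elementary_left[OF assms E(1)]
      decomposable_cong[of "bloch (\<lambda>x. reflection n (f x))" "\<lambda>\<rho>. E (bloch f \<rho>)"] by simp
qed

lemma decomposable_bloch_reflection_right:
  assumes "decomposable (bloch f)"
  shows "decomposable (bloch (\<lambda>x. f (reflection n x)))"
proof -
  obtain E where E: "elementary E" "\<And>t x. E (pauli t x) = pauli t (reflection n x)"
    using reflection_elementary by blast
  have "bloch (\<lambda>x. f (reflection n x)) \<rho> = bloch f (E \<rho>)" if "\<rho> \<in> hermitian_matrices" for \<rho>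
    using that E by (elim hermitian_obtain_pauli) simp
  then show ?thesis
    using decomposable_elementary_right[OF assms E(1)]
      decomposable_cong[of "bloch (\<lambda>x. f (reflection n x))" "\<lambda>\<rho>. bloch f (E \<rho>)"] by simp
qed


section \<open>Diagonal contractions and the vertices of the cube\<close>

lemma reflection_axis:
  "reflection (axis j 1) (x :: real^'n) = (\<chi> i. if i = j then - x $ i else x $ i)"
  by (simp add: reflection_def inner_axis inner_axis_axis vec_eq_iff) (simp add: axis_def)

text \<open>A product of reflections in coordinate hyperplanes; distinctness prevents a coordinate
  from being flipped twice.\<close>

lemma sign_flips_elementary:
  assumes "distinct is"
  shows "\<exists>E. elementary E \<and>
    (\<forall>t x. E (pauli t x) = pauli t (\<chi> i. if i \<in> set is then - x $ i else x $ i))"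
  using assms
proof (induction "is")
  case Nil
  then show ?case
    using elementary_id by (intro exI[of _ "\<lambda>\<rho>. \<rho>"]) simp
next
  case (Cons j "is")
  then obtain E where E: "elementary E"
    "\<And>t x. E (pauli t x) = pauli t (\<chi> i. if i \<in> set is then - x $ i else x $ i)"
    by auto
  obtain F where F: "elementary F" "\<And>t x. F (pauli t x) = pauli t (reflection (axis j 1) x)"
    using reflection_elementary by blast
  have "reflection (axis j 1) (\<chi> i. if i \<in> set is then - x $ i else x $ i)
      = (\<chi> i. if i \<in> set (j # is) then - x $ i else x $ i)" for x :: "real^3"
    using Cons.prems by (auto simp: reflection_axis vec_eq_iff)
  then show ?case
    using elementary_compose[OF F(1) E(1)] by (intro exI[of _ "\<lambda>\<rho>. F (E \<rho>)"]) (simp add: E F)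
qed

lemma order_3:
  fixes s :: "3 \<Rightarrow> real"
  obtains i j k where "distinct [i, j, k]" "s i \<ge> s j" "s j \<ge> s k"
proof -
  have "distinct [1, 2, 3 :: 3]"
    by simp
  then show ?thesis
    using that[of 1 2 3] that[of 1 3 2] that[of 2 1 3] that[of 2 3 1] that[of 3 1 2] that[of 3 2 1]
    by (simp add: eq_commute) linarith
qed

text \<open>If \<open>s i \<ge> s j \<ge> s k\<close>, then \<open>s\<close> is the convex combination of the vertices
  \<open>(1, 1, 1)\<close>, \<open>(1, 1, -1)\<close>, \<open>(1, -1, -1)\<close>, \<open>(-1, -1, -1)\<close> of the cube, in the coordinates
  \<open>i, j, k\<close>, with weights \<open>(1 + s k) / 2\<close>, \<open>(s j - s k) / 2\<close>, \<open>(s i - s j) / 2\<close>, \<open>(1 - s i) / 2\<close>.\<close>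

lemma decomposable_bloch_diagonal:
  fixes s :: "3 \<Rightarrow> real"
  assumes s: "\<And>i. \<bar>s i\<bar> \<le> 1"
  shows "decomposable (bloch (\<lambda>x. \<chi> i. s i * x $ i))"
proof -
  obtain i j k where ijk: "distinct [i, j, k]" "s i \<ge> s j" "s j \<ge> s k"
    by (rule order_3)
  have UNIV3: "l = i \<or> l = j \<or> l = k" for l :: 3
  proof -
    have "card {i, j, k} = card (UNIV :: 3 set)"
      using ijk(1) by simp
    then have "{i, j, k} = UNIV"
      by (intro card_subset_eq) auto
    then show ?thesis
      by blast
  qed
  obtain E0 where E0: "elementary E0"
    "\<And>t x. E0 (pauli t x) = pauli t (\<chi> l. if l \<in> set [] then - x $ l else x $ l)"
    using sign_flips_elementary[of "[]"] ijk(1) by auto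
  obtain E1 where E1: "elementary E1"
    "\<And>t x. E1 (pauli t x) = pauli t (\<chi> l. if l \<in> set [k] then - x $ l else x $ l)"
    using sign_flips_elementary[of "[k]"] ijk(1) by auto
  obtain E2 where E2: "elementary E2"
    "\<And>t x. E2 (pauli t x) = pauli t (\<chi> l. if l \<in> set [j, k] then - x $ l else x $ l)"
    using sign_flips_elementary[of "[j, k]"] ijk(1) by auto
  obtain E3 where E3: "elementary E3"
    "\<And>t x. E3 (pauli t x) = pauli t (\<chi> l. if l \<in> set [i, j, k] then - x $ l else x $ l)"
    using sign_flips_elementary[of "[i, j, k]"] ijk(1) by auto
  define T :: "4 \<Rightarrow> _" where "T = (\<lambda>n.
      if n = 0 then (\<lambda>\<rho>. ((1 + s k) / 2) *\<^sub>R E0 \<rho>)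
      else if n = 1 then (\<lambda>\<rho>. ((s j - s k) / 2) *\<^sub>R E1 \<rho>)
      else if n = 2 then (\<lambda>\<rho>. ((s i - s j) / 2) *\<^sub>R E2 \<rho>)
      else (\<lambda>\<rho>. ((1 - s i) / 2) *\<^sub>R E3 \<rho>))"
  have "0 \<le> 1 + s k" "0 \<le> 1 - s i"
    using s[of k] s[of i] by linarith+
  then have "elementary (T n)" for n
    using E0 E1 E2 E3 ijk by (auto simp: T_def intro!: elementary_scaleR)
  moreover have "bloch (\<lambda>x. \<chi> l. s l * x $ l) \<rho> = (\<Sum>n\<in>UNIV. T n \<rho>)"
    if "\<rho> \<in> hermitian_matrices" for \<rho>
  proof -
    obtain t x where \<rho>: "\<rho> = pauli t x"
      using \<open>\<rho> \<in> hermitian_matrices\<close> by (rule hermitian_obtain_pauli)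
    have "(\<Sum>n\<in>UNIV. T n \<rho>) = ((1 + s k) / 2) *\<^sub>R E0 \<rho> + ((s j - s k) / 2) *\<^sub>R E1 \<rho>
        + ((s i - s j) / 2) *\<^sub>R E2 \<rho> + ((1 - s i) / 2) *\<^sub>R E3 \<rho>"
      by (simp add: sum_4 T_def)
    also have "\<dots> = pauli t (\<chi> l. s l * x $ l)"
    proof -
      have "(1 + s k) / 2 * t + (s j - s k) / 2 * t + (s i - s j) / 2 * t + (1 - s i) / 2 * t = t"
        by (simp add: field_simps)
      moreover have "((1 + s k) / 2 * (if l \<in> set [] then - x $ l else x $ l)
          + (s j - s k) / 2 * (if l \<in> set [k] then - x $ l else x $ l)
          + (s i - s j) / 2 * (if l \<in> set [j, k] then - x $ l else x $ l)
          + (1 - s i) / 2 * (if l \<in> set [i, j, k] then - x $ l else x $ l)) = s l * x $ l" for l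
        using UNIV3[of l] ijk(1) by (elim disjE) (simp_all add: field_simps)
      ultimately show ?thesis
        unfolding \<rho> E0 E1 E2 E3 pauli_scaleR pauli_add pauli_inject by (simp add: vec_eq_iff)
    qed
    finally show ?thesis
      by (simp add: \<rho>)
  qed
  ultimately show ?thesis
    unfolding decomposable_def by blast
qed

lemma decomposable_bloch_contraction:
  assumes "linear f" "\<And>x. norm (f x) \<le> norm x"
  shows "decomposable (bloch f)"
proof (rule singular_value_induct[where P = "\<lambda>f. decomposable (bloch f)"])
  fix s :: "real^3 \<Rightarrow> real"
  assume s: "\<And>b. b \<in> Basis \<Longrightarrow> \<bar>s b\<bar> \<le> 1"
  have "(\<Sum>b\<in>Basis. (s b * (x \<bullet> b)) *\<^sub>R b) = (\<chi> i. s (axis i 1) * x $ i)" for x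
  proof (rule euclidean_eqI)
    fix b :: "real^3"
    assume b: "b \<in> Basis"
    then have "(\<Sum>b\<in>Basis. (s b * (x \<bullet> b)) *\<^sub>R b) \<bullet> b = s b * (x \<bullet> b)"
      by simp
    moreover obtain i where "b = axis i 1"
      using b by (auto simp: Basis_vec_def)
    ultimately show "(\<Sum>b\<in>Basis. (s b * (x \<bullet> b)) *\<^sub>R b) \<bullet> b = (\<chi> i. s (axis i 1) * x $ i) \<bullet> b"
      by (simp add: inner_axis)
  qed
  then show "decomposable (bloch (\<lambda>x. \<Sum>b\<in>Basis. (s b * (x \<bullet> b)) *\<^sub>R b))"
    using s decomposable_bloch_diagonal[of "\<lambda>i. s (axis i 1)"] by simp
qed (use assms decomposable_bloch_reflection_left decomposable_bloch_reflection_right in auto)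

subsection \<open>Determinants and positivity\<close>

text \<open>The eigenvalues are \<open>t - norm x\<close> and \<open>t + norm x\<close>. Instead of
  diagonalising, one direction evaluates the quadratic form at test vectors, and the other uses the
  inequality of arithmetic and geometric means.\<close>

lemma psd_pauli: "positive_semidefinite (pauli t x) \<longleftrightarrow> norm x \<le> t"
proof
  assume psd: "positive_semidefinite (pauli t x)"
  have form: "0 \<le> (t + x $ 3) * (cmod p)\<^sup>2 + (t - x $ 3) * (cmod q)\<^sup>2
     + 2 * Re (cnj p * Complex (x $ 1) (- x $ 2) * q)" for p q
    using psd unfolding positive_semidefinite_def quadratic_form_pauli
    by (auto dest: spec[of _ "vector [p, q] :: complex^2"])
  have ab: "0 \<le> t + x $ 3" "0 \<le> t - x $ 3"
    using form[of 1 0] form[of 0 1] by simp_all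
  show "norm x \<le> t"
  proof (cases "t = 0")
    case True
    have "x $ 3 = 0"
      using ab True by simp
    moreover have "(x $ 1)\<^sup>2 + (x $ 2)\<^sup>2 \<le> 0"
      using form[of 1 "- Complex (x $ 1) (x $ 2)"] True \<open>x $ 3 = 0\<close>
      by (simp add: power2_eq_square)
    then have "x $ 1 = 0" "x $ 2 = 0"
      by (simp_all add: sum_power2_le_zero_iff)
    ultimately have "x = 0"
      by (simp add: vec_eq_iff forall_3)
    then show ?thesis
      using True by simp
  next
    case False
    then have "t > 0"
      using ab by simp
    \<comment> \<open>The test vectors are the two columns of the adjugate. The form takes there the
      values of the determinant times \<open>t + x $ 3\<close> and times \<open>t - x $ 3\<close>,
      and these are added. For \<open>t = 0\<close> the sum carries no information, hence the
      separate case.\<close>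
    have "0 \<le> 2 * t * (t\<^sup>2 - x \<bullet> x)"
      using form[of "- Complex (x $ 1) (- x $ 2)" "Complex (t + x $ 3) 0", unfolded cmod_power2]
        form[of "Complex (t - x $ 3) 0" "- Complex (x $ 1) (x $ 2)", unfolded cmod_power2]
      by (simp add: inner_3 power2_eq_square algebra_simps)
    then have "x \<bullet> x \<le> t\<^sup>2"
      using \<open>t > 0\<close> by (simp add: zero_le_mult_iff)
    then show ?thesis
      using \<open>t > 0\<close> by (simp add: norm_le_square)
  qed
next
  assume le: "norm x \<le> t"
  then have "0 \<le> t"
    using norm_ge_zero order_trans by blast
  have xt: "x \<bullet> x \<le> t\<^sup>2"
    using le \<open>0 \<le> t\<close> by (simp add: norm_le_square)
  \<comment> \<open>The diagonal entries and the modulus of the off-diagonal entry;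
    \<open>W\<^sup>2 \<le> a * b\<close> says that the determinant is nonnegative.\<close>
  define a b W where "a = t + x $ 3" and "b = t - x $ 3" and "W = cmod (Complex (x $ 1) (- x $ 2))"
  have "\<bar>x $ 3\<bar> \<le> t"
    using component_le_norm_cart[of x 3] le by linarith
  then have ab: "0 \<le> a" "0 \<le> b"
    by (simp_all add: a_def b_def)
  have "W\<^sup>2 = (x $ 1)\<^sup>2 + (x $ 2)\<^sup>2"
    by (simp add: W_def cmod_power2)
  then have W: "W\<^sup>2 \<le> a * b" "0 \<le> W"
    using xt by (simp_all add: W_def a_def b_def inner_3 power2_eq_square algebra_simps)
  have "0 \<le> a * (cmod p)\<^sup>2 + b * (cmod q)\<^sup>2 + 2 * Re (cnj p * Complex (x $ 1) (- x $ 2) * q)" for p q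
  proof -
    have "(2 * W * cmod p * cmod q)\<^sup>2 = W\<^sup>2 * (4 * (cmod p)\<^sup>2 * (cmod q)\<^sup>2)"
      by (simp add: power_mult_distrib)
    also have "\<dots> \<le> a * b * (4 * (cmod p)\<^sup>2 * (cmod q)\<^sup>2)"
      using W by (intro mult_right_mono) auto
    also have "\<dots> \<le> (a * (cmod p)\<^sup>2 + b * (cmod q)\<^sup>2)\<^sup>2"
      using zero_le_power2[of "a * (cmod p)\<^sup>2 - b * (cmod q)\<^sup>2"]
      by (simp add: power2_eq_square algebra_simps)
    finally have "2 * W * cmod p * cmod q \<le> a * (cmod p)\<^sup>2 + b * (cmod q)\<^sup>2"
      by (rule power2_le_imp_le) (simp add: ab)
    moreover have "\<bar>Re (cnj p * Complex (x $ 1) (- x $ 2) * q)\<bar> \<le> W * cmod p * cmod q"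
      using abs_Re_le_cmod[of "cnj p * Complex (x $ 1) (- x $ 2) * q"]
      by (simp add: norm_mult W_def mult_ac)
    ultimately show ?thesis
      by linarith
  qed
  then show "positive_semidefinite (pauli t x)"
    unfolding positive_semidefinite_def quadratic_form_pauli a_def b_def
    by (simp add: hermitian_pauli)
qed

section \<open>Determinants, whitening and the Frobenius norm\<close>

lemma det_scaleR_2: "det (c *\<^sub>R (A :: complex^2^2)) = of_real (c\<^sup>2) * det A"
  by (simp add: det_2 scaleR_conv_of_real[where 'a = complex] power2_eq_square algebra_simps)

text \<open>All factors are polynomials in \<open>X = pauli 0 x\<close>, so they commute and the
  product is \<open>(s - X)\<^sup>2 (t + X)\<close>, reduced by the fact that the square of
  \<open>X\<close> is the scalar \<open>x \<bullet> x\<close>.\<close>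

lemma congruence_pauli_neg:
  "congruence (pauli s (- x)) (pauli t x) =
     pauli (s\<^sup>2 * t - 2 * s * (x \<bullet> x) + t * (x \<bullet> x)) ((s\<^sup>2 - 2 * s * t + x \<bullet> x) *\<^sub>R x)"
  by (simp add: congruence_def matrix_eq_2 matrix_matrix_mult_def sum_2 dagger_component
      complex_eq_iff inner_3 power2_eq_square algebra_simps)

text \<open>The witness is the inverse square root \<open>P\<^sup>-\<^sup>1\<^sup>/\<^sup>2\<close> of \<open>P = pauli t x\<close>: since
  \<open>(P + r)\<^sup>2 = 2 (t + r) P\<close> for \<open>r = sqrt (det P)\<close>, it is proportional to the adjugate of \<open>P + r\<close>.\<close>

lemma pauli_whitening:
  assumes "norm x < t"
  obtains B where "det B \<noteq> 0" "congruence B (pauli t x) = mat 1"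
proof -
  have t: "t > 0"
    using assms norm_ge_zero[of x] by linarith
  define r where "r = sqrt (t\<^sup>2 - x \<bullet> x)"
  have "x \<bullet> x < t\<^sup>2"
    using assms t by (simp add: norm_lt_square)
  then have r: "r > 0" "r\<^sup>2 = t\<^sup>2 - x \<bullet> x"
    by (simp_all add: r_def)
  then have q: "x \<bullet> x = t\<^sup>2 - r\<^sup>2"
    by simp
  \<comment> \<open>For \<open>s = t + r\<close> and
    \<open>x \<bullet> x = t\<^sup>2 - r\<^sup>2\<close> the vector part in
    \<open>congruence_pauli_neg\<close> vanishes and the scalar part is \<open>c\<close>.\<close>
  define c where "c = 2 * r\<^sup>2 * (t + r)"
  have c: "c > 0"
    using r(1) t by (simp add: c_def)
  define B where "B = (1 / sqrt c) *\<^sub>R pauli (t + r) (- x)"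
  have "congruence (pauli (t + r) (- x)) (pauli t x) = pauli c 0"
    unfolding congruence_pauli_neg q c_def by (simp add: power2_eq_square algebra_simps)
  then have "congruence B (pauli t x) = mat 1"
    using c unfolding B_def congruence_scaleR
    by (simp add: pauli_scaleR power_divide mat_1_eq_pauli)
  moreover have "(t + r)\<^sup>2 - x \<bullet> x = 2 * r * (t + r)"
    unfolding q by (simp add: power2_eq_square algebra_simps)
  then have "det B \<noteq> 0"
    using c r(1) t unfolding B_def det_scaleR_2 det_pauli by (simp del: of_real_add of_real_diff of_real_power)
  ultimately show ?thesis
    using that by blast
qed

lemma det_congruence: "det (congruence (A :: complex^2^2) \<rho>) = of_real ((cmod (det A))\<^sup>2) * det \<rho>"
proof -
  have "det (dagger A) = cnj (det A)"
    by (simp add: det_2 dagger_component)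
  then show ?thesis
    by (simp add: congruence_def det_mul complex_norm_square mult_ac del: of_real_power)
qed

text \<open>The norm of the matrix type is the Frobenius norm. This turns control of traces into
  bounds on the matrices themselves.\<close>

lemma trace_congruence_mat_1: "Re (trace (congruence A (mat 1))) = (norm A)\<^sup>2"
proof -
  have "congruence A (mat 1) = A ** dagger A"
    by (simp add: congruence_def)
  then show ?thesis
    by (simp add: trace_def matrix_matrix_mult_def dagger_component power2_norm_eq_inner
        inner_vec_def inner_complex_def)
qed

lemma continuous_on_congruence: "continuous_on S (\<lambda>A. congruence A \<rho>)"
  unfolding congruence_def matrix_matrix_mult_def dagger_def
  by (intro continuous_intros continuous_on_vec_lambda)

text \<open>Equality holds in \<open>bound\<close> at \<open>C = mat 1\<close>, so the first
  variation there vanishes. Along \<open>C = pauli 1 (s *\<^sub>R h)\<close> its linear coefficient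
  is a multiple of \<tau>, half the trace of \<open>\<Phi> (pauli 0 h)\<close>. Allowing every
  positive determinant \<delta> spares normalising \<open>C\<close>.\<close>

lemma trace_preserving_of_det_bound:
  assumes "linear \<Phi>" and herm: "\<And>\<rho>. \<rho> \<in> hermitian_matrices \<Longrightarrow> \<Phi> \<rho> \<in> hermitian_matrices"
    and unital: "\<Phi> (mat 1) = mat 1"
    and bound: "\<And>C \<delta>. det C = of_real \<delta> \<Longrightarrow> 0 < \<delta> \<Longrightarrow> \<delta>\<^sup>2 \<le> Re (det (\<Phi> (congruence C (mat 1))))"
  obtains k where "\<Phi> (pauli 0 h) = pauli 0 k"
proof -
  obtain \<tau> k where k: "\<Phi> (pauli 0 h) = pauli \<tau> k"
    using herm[OF hermitian_pauli] by (rule hermitian_obtain_pauli)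
  define q where "q = h \<bullet> h"
  have q: "q \<ge> 0"
    by (simp add: q_def)
  have ineq: "0 \<le> (1 + s * \<tau>) * (s\<^sup>2 * q + s * \<tau>)" if s: "s\<^sup>2 * q < 1" for s
  proof -
    have "pauli (1 + s\<^sup>2 * q) ((2 * s) *\<^sub>R h) = (1 + s\<^sup>2 * q) *\<^sub>R mat 1 + (2 * s) *\<^sub>R pauli 0 h"
      by (simp add: mat_1_eq_pauli pauli_scaleR pauli_add)
    then have "\<Phi> (pauli (1 + s\<^sup>2 * q) ((2 * s) *\<^sub>R h)) = pauli (1 + s\<^sup>2 * q + 2 * s * \<tau>) ((2 * s) *\<^sub>R k)"
      by (simp only: linear_add[OF \<open>linear \<Phi>\<close>] linear_cmul[OF \<open>linear \<Phi>\<close>] k unital)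
         (simp add: mat_1_eq_pauli pauli_scaleR pauli_add)
    moreover have "congruence (pauli 1 (s *\<^sub>R h)) (mat 1) = pauli (1 + s\<^sup>2 * q) ((2 * s) *\<^sub>R h)"
      by (simp add: pauli_square q_def power2_eq_square)
    moreover have "det (pauli 1 (s *\<^sub>R h)) = of_real (1 - s\<^sup>2 * q)"
      by (simp add: det_pauli q_def power2_eq_square)
    ultimately have "(1 - s\<^sup>2 * q)\<^sup>2 \<le> (1 + s\<^sup>2 * q + 2 * s * \<tau>)\<^sup>2 - ((2 * s) *\<^sub>R k) \<bullet> ((2 * s) *\<^sub>R k)"
      using bound[of "pauli 1 (s *\<^sub>R h)" "1 - s\<^sup>2 * q"] s by (simp add: det_pauli)
    then have "(1 - s\<^sup>2 * q)\<^sup>2 \<le> (1 + s\<^sup>2 * q + 2 * s * \<tau>)\<^sup>2"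
      using inner_ge_zero[of "(2 * s) *\<^sub>R k"] by linarith
    then show ?thesis
      by (simp add: power2_eq_square algebra_simps)
  qed
  have "\<tau> = 0"
  proof (rule ccontr)
    assume "\<tau> \<noteq> 0"
    \<comment> \<open>At \<open>s = - (\<tau> * \<delta>)\<close> the product in \<open>ineq\<close>
      is \<open>- ((1 - \<delta> * \<tau>\<^sup>2) * (1 - \<delta> * q) * (\<delta> *
      \<tau>\<^sup>2))\<close>; this \<delta> is small enough for both differences to be
      positive.\<close>
    define \<delta> where "\<delta> = 1 / (2 * (1 + \<tau>\<^sup>2 + q))"
    have pos: "1 + \<tau>\<^sup>2 + q > 0"
      using q by (intro add_pos_nonneg) auto
    then have \<delta>: "\<delta> > 0"
      by (simp add: \<delta>_def)
    have sum: "2 * \<delta> + 2 * (\<delta> * \<tau>\<^sup>2) + 2 * (\<delta> * q) = 1"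
    proof -
      have "2 * \<delta> + 2 * (\<delta> * \<tau>\<^sup>2) + 2 * (\<delta> * q) = \<delta> * (2 * (1 + \<tau>\<^sup>2 + q))"
        by (simp add: algebra_simps)
      then show ?thesis
        using pos by (simp add: \<delta>_def)
    qed
    have "\<delta> * \<tau>\<^sup>2 \<ge> 0" "\<delta> * q \<ge> 0"
      using \<delta> q by simp_all
    then have \<delta>: "\<delta> > 0" "\<delta> * \<tau>\<^sup>2 < 1" "\<delta> * q < 1"
      using \<delta> sum by linarith+
    have "(- (\<tau> * \<delta>))\<^sup>2 * q = (\<delta> * \<tau>\<^sup>2) * (\<delta> * q)"
      by (simp add: power2_eq_square)
    also have "\<dots> < 1 * 1"
      using \<delta> q by (intro mult_strict_mono') auto
    finally have "0 \<le> (1 + (- (\<tau> * \<delta>)) * \<tau>) * ((- (\<tau> * \<delta>))\<^sup>2 * q + (- (\<tau> * \<delta>)) * \<tau>)"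
      by (intro ineq) simp
    also have "\<dots> = - ((1 - \<delta> * \<tau>\<^sup>2) * (1 - \<delta> * q) * (\<delta> * \<tau>\<^sup>2))"
      by (simp add: power2_eq_square algebra_simps)
    also have "\<dots> < 0"
      using \<delta> \<open>\<tau> \<noteq> 0\<close> by simp
    finally show False
      by simp
  qed
  then show ?thesis
    using k that by blast
qed

text \<open>On Hermitian matrices such a map is \<open>bloch f\<close> for a linear
  \<open>f\<close>. Positivity on the boundary points \<open>pauli (norm x) x\<close> of the cone
  says that \<open>f\<close> is a contraction.\<close>

lemma decomposable_of_unital_trace_preserving:
  assumes "linear \<Phi>" "positivity_preserving \<Phi>" "\<Phi> (mat 1) = mat 1"
    and traceless: "\<And>h. \<exists>k. \<Phi> (pauli 0 h) = pauli 0 k"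
  shows "decomposable \<Phi>"
proof -
  define f where "f h = bloch_vector (\<Phi> (pauli 0 h))" for h
  have f: "\<Phi> (pauli 0 h) = pauli 0 (f h)" for h
    using traceless[of h] by (auto simp: f_def)
  have pauli: "\<Phi> (pauli t x) = pauli t (f x)" for t x
  proof -
    have "pauli t x = t *\<^sub>R mat 1 + pauli 0 x"
      by (simp add: mat_1_eq_pauli pauli_scaleR pauli_add)
    then show ?thesis
      using assms(3) by (simp add: linear_add[OF assms(1)] linear_cmul[OF assms(1)] f)
        (simp add: mat_1_eq_pauli pauli_scaleR pauli_add)
  qed
  have "linear f"
  proof (rule linearI)
    show "f (x + y) = f x + f y" for x y
      using linear_add[OF assms(1), of "pauli 0 x" "pauli 0 y"] by (simp add: pauli_add f)
    show "f (c *\<^sub>R x) = c *\<^sub>R f x" for c x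
      using linear_cmul[OF assms(1), of c "pauli 0 x"] by (simp add: pauli_scaleR f)
  qed
  moreover have "norm (f x) \<le> norm x" for x
  proof -
    have "positive_semidefinite (\<Phi> (pauli (norm x) x))"
      using assms(2) by (simp add: positivity_preserving_def psd_pauli)
    then show ?thesis
      by (simp add: pauli psd_pauli)
  qed
  ultimately have "decomposable (bloch f)"
    by (rule decomposable_bloch_contraction)
  moreover have "\<Phi> \<rho> = bloch f \<rho>" if "\<rho> \<in> hermitian_matrices" for \<rho>
    using that by (rule hermitian_obtain_pauli) (simp add: pauli)
  ultimately show ?thesis
    using decomposable_cong[of \<Phi> "bloch f"] by simp
qed

subsection \<open>Scaling to a unital trace-preserving map\<close>

lemma congruence_inverse:
  fixes A :: "complex^'n^'n"
  assumes "det A \<noteq> 0"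
  obtains A' where "\<And>\<rho>. congruence A' (congruence A \<rho>) = \<rho>" "\<And>\<rho>. congruence A (congruence A' \<rho>) = \<rho>"
proof -
  obtain A' where "A ** A' = mat 1" "A' ** A = mat 1"
    using assms invertible_det_nz unfolding invertible_def by blast
  then show ?thesis
    using that[of A'] by (simp add: congruence_mult)
qed

text \<open>The set \<open>det A = 1\<close> is closed but unbounded; the quartic lower bound makes
  the functional coercive, so it suffices to minimise over a ball.\<close>

lemma det_functional_attains_min:
  fixes \<Phi> :: "complex^2^2 \<Rightarrow> complex^2^2"
  assumes "linear \<Phi>" "\<epsilon> > 0"
    and lower: "\<And>A. \<epsilon> * norm A ^ 4 \<le> Re (det (\<Phi> (congruence A (mat 1))))"
  obtains A0 where "det A0 = 1"
    "\<And>A. det A = 1 \<Longrightarrow> Re (det (\<Phi> (congruence A0 (mat 1)))) \<le> Re (det (\<Phi> (congruence A (mat 1))))"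
proof -
  define F where "F A = Re (det (\<Phi> (congruence A (mat 1))))" for A
  have cont_\<Phi>: "continuous_on S (\<lambda>A. \<Phi> (congruence A (mat 1)))" for S
    using linear_continuous_on_compose[OF continuous_on_congruence assms(1)] .
  have cont_F: "continuous_on S F" for S
    unfolding F_def det_2 by (intro continuous_intros cont_\<Phi>)
  \<comment> \<open>Large enough that the ball contains the identity, that
    \<open>r \<le> r ^ 4\<close>, and that \<open>F (mat 1) \<le> \<epsilon> * r\<close>. Outside
    the ball \<open>F\<close> is then at least its value at the identity.\<close>
  define r where "r = 1 + norm (mat 1 :: complex^2^2) + F (mat 1) / \<epsilon>"
  have F_pos: "F A \<ge> 0" for A
    using lower[of A] \<open>\<epsilon> > 0\<close> by (auto simp: F_def intro: order_trans[rotated])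
  have "F (mat 1) / \<epsilon> \<ge> 0"
    using F_pos[of "mat 1"] \<open>\<epsilon> > 0\<close> by simp
  then have r: "r \<ge> 1" "norm (mat 1 :: complex^2^2) \<le> r" "F (mat 1) / \<epsilon> \<le> r"
    using norm_ge_zero[of "mat 1 :: complex^2^2"] unfolding r_def by linarith+
  define S where "S = {A :: complex^2^2. det A = 1} \<inter> cball 0 r"
  have "closed {A :: complex^2^2. det A = 1}"
    unfolding det_2 by (intro closed_Collect_eq continuous_intros)
  then have "compact S"
    unfolding S_def by (intro closed_Int_compact compact_cball)
  moreover have one: "mat 1 \<in> S"
    using r by (simp add: S_def)
  ultimately obtain A0 where A0: "A0 \<in> S" "\<And>A. A \<in> S \<Longrightarrow> F A0 \<le> F A"
    using continuous_attains_inf[of S F] cont_F by (metis empty_iff)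
  have "F A0 \<le> F A" if "det A = 1" for A
  proof (cases "norm A \<le> r")
    case True
    then show ?thesis
      using A0 that by (simp add: S_def)
  next
    case False
    have "F (mat 1) \<le> \<epsilon> * r"
      using r(3) \<open>\<epsilon> > 0\<close> by (simp add: field_simps)
    also have "r \<le> norm A ^ 4"
    proof -
      have "r \<le> norm A"
        using False by simp
      also have "\<dots> = norm A ^ 1"
        by simp
      also have "\<dots> \<le> norm A ^ 4"
        using False r(1) by (intro power_increasing) auto
      finally show ?thesis .
    qed
    then have "\<epsilon> * r \<le> \<epsilon> * norm A ^ 4"
      using \<open>\<epsilon> > 0\<close> by (intro mult_left_mono) auto
    also have "\<dots> \<le> F A"
      using lower by (simp add: F_def)
    finally show ?thesis
      using A0(2)[OF one] by linarith
  qed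
  then show ?thesis
    using that A0(1) by (auto simp: S_def F_def)
qed

text \<open>Congruence by the minimiser \<open>A0\<close> on the input and whitening by
  \<open>B\<close> on the output give a unital \<Psi> whose determinant functional is minimal at the
  identity. Both congruences are invertible, so a decomposition of \<Psi> yields one of
  \<Phi>.\<close>

lemma decomposable_of_det_lower_bound:
  fixes \<Phi> :: "complex^2^2 \<Rightarrow> complex^2^2"
  assumes "linear \<Phi>" "positivity_preserving \<Phi>" "\<epsilon> > 0"
    and herm: "\<And>\<rho>. \<rho> \<in> hermitian_matrices \<Longrightarrow> \<Phi> \<rho> \<in> hermitian_matrices"
    and lower: "\<And>A. \<epsilon> * norm A ^ 4 \<le> Re (det (\<Phi> (congruence A (mat 1))))"
  shows "decomposable \<Phi>"
proof -
  obtain A0 where A0: "det A0 = 1"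
    "\<And>A. det A = 1 \<Longrightarrow> Re (det (\<Phi> (congruence A0 (mat 1)))) \<le> Re (det (\<Phi> (congruence A (mat 1))))"
    using det_functional_attains_min[OF assms(1,3) lower] by blast
  define m where "m = Re (det (\<Phi> (congruence A0 (mat 1))))"
  have "A0 \<noteq> 0"
    using A0(1) by (auto simp: det_2)
  then have "0 < \<epsilon> * norm A0 ^ 4"
    using \<open>\<epsilon> > 0\<close> by simp
  then have "m > 0"
    using lower[of A0] by (simp add: m_def)
  obtain p x where p: "\<Phi> (congruence A0 (mat 1)) = pauli p x"
    using herm[OF hermitian_congruence[OF hermitian_mat_1]] by (rule hermitian_obtain_pauli)
  have "positive_semidefinite (mat 1 :: complex^2^2)"
    by (simp add: mat_1_eq_pauli psd_pauli)
  then have "norm x \<le> p"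
    using assms(2) psd_congruence p psd_pauli unfolding positivity_preserving_def by metis
  moreover have "p\<^sup>2 - x \<bullet> x = m"
    by (simp add: m_def p det_pauli)
  \<comment> \<open>A positive minimum makes the image of \<open>congruence A0 (mat 1)\<close>
    positive definite, hence whitening applies.\<close>
  then have "norm x \<noteq> p"
    using \<open>m > 0\<close> by (auto simp: power2_norm_eq_inner)
  ultimately obtain B where B: "det B \<noteq> 0" "congruence B (pauli p x) = mat 1"
    using pauli_whitening[of x p] by auto
  define \<Psi> where "\<Psi> \<rho> = congruence B (\<Phi> (congruence A0 \<rho>))" for \<rho>
  have lin: "linear \<Psi>"
    using linear_compose[OF linear_compose[OF linear_congruence assms(1)] linear_congruence]
    by (simp add: \<Psi>_def[abs_def] o_def)
  have unital: "\<Psi> (mat 1) = mat 1"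
    by (simp add: \<Psi>_def p B)
  have det_B: "(cmod (det B))\<^sup>2 * m = 1"
    using det_congruence[of B "pauli p x"] B(2) by (simp add: m_def p complex_eq_iff)
  have "\<delta>\<^sup>2 \<le> Re (det (\<Psi> (congruence C (mat 1))))" if \<delta>: "det C = of_real \<delta>" "\<delta> > 0" for C \<delta>
  proof -
    \<comment> \<open>Rescaled to determinant 1, as the minimality of \<open>A0\<close> requires.
      Congruence then scales by \<open>1 / \<delta>\<close>, and the determinant of the image by the
      square of that.\<close>
    define C' where "C' = (1 / sqrt \<delta>) *\<^sub>R C"
    have "det (A0 ** C') = 1"
      using \<delta> A0(1) by (simp add: C'_def det_mul det_scaleR_2 power_divide flip: of_real_power)
    then have "m \<le> Re (det (\<Phi> (congruence (A0 ** C') (mat 1))))"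
      unfolding m_def by (rule A0(2))
    also have "congruence (A0 ** C') (mat 1) = (1 / \<delta>) *\<^sub>R congruence A0 (congruence C (mat 1))"
      using \<delta> by (simp add: C'_def congruence_mult[symmetric] congruence_scaleR
          linear_cmul[OF linear_congruence] power_divide)
    also have "Re (det (\<Phi> \<dots>)) = (1 / \<delta>)\<^sup>2 * Re (det (\<Phi> (congruence A0 (congruence C (mat 1)))))"
      by (simp add: linear_cmul[OF assms(1)] det_scaleR_2 flip: of_real_power of_real_divide)
    finally have "\<delta>\<^sup>2 * m \<le> Re (det (\<Phi> (congruence A0 (congruence C (mat 1)))))"
      using \<delta>(2) by (simp add: field_simps)
    then have "(cmod (det B))\<^sup>2 * (\<delta>\<^sup>2 * m)
        \<le> (cmod (det B))\<^sup>2 * Re (det (\<Phi> (congruence A0 (congruence C (mat 1)))))"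
      by (intro mult_left_mono) auto
    moreover have "(cmod (det B))\<^sup>2 * (\<delta>\<^sup>2 * m) = \<delta>\<^sup>2"
      using det_B by (metis mult.left_commute mult.right_neutral)
    ultimately show ?thesis
      by (simp add: \<Psi>_def det_congruence del: of_real_power)
  qed
  moreover have "\<Psi> \<rho> \<in> hermitian_matrices" if "\<rho> \<in> hermitian_matrices" for \<rho>
    using that by (simp add: \<Psi>_def hermitian_congruence herm)
  ultimately have "\<exists>k. \<Psi> (pauli 0 h) = pauli 0 k" for h
    using trace_preserving_of_det_bound[OF lin _ unital] by metis
  moreover have "positivity_preserving \<Psi>"
    using assms(2) by (simp add: positivity_preserving_def \<Psi>_def psd_congruence)
  ultimately have dec: "decomposable \<Psi>"
    using decomposable_of_unital_trace_preserving lin unital by blast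
  obtain A' where A': "\<And>\<rho>. congruence A0 (congruence A' \<rho>) = \<rho>"
    using congruence_inverse[of A0] A0(1) by (metis zero_neq_one)
  obtain B' where B': "\<And>\<rho>. congruence B' (congruence B \<rho>) = \<rho>"
    using congruence_inverse[OF B(1)] by metis
  have "decomposable (\<lambda>\<rho>. congruence B' (\<Psi> (congruence A' \<rho>)))"
    by (intro decomposable_elementary_left[OF _ elementary_congruence]
        decomposable_elementary_right[OF dec elementary_congruence])
  then show ?thesis
    by (simp add: \<Psi>_def A' B')
qed

subsection \<open>Limits\<close>

lemma trace_sum: "trace (\<Sum>i\<in>I. f i) = (\<Sum>i\<in>I. trace (f i :: complex^'n^'n))"
  unfolding trace_def sum_component by (rule sum.swap)

text \<open>The squared norms of the matrices representing \<open>\<Phi>s n\<close> add up to the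
  trace of \<open>\<Phi>s n (mat 1)\<close>, which converges. The matrices are therefore bounded,
  and the terms of a convergent subsequence pass to the limit.\<close>

lemma decomposable_limit:
  fixes \<Phi> :: "complex^'n^'n \<Rightarrow> complex^'n^'n"
  assumes "\<And>n. decomposable (\<Phi>s n)"
    and lim: "\<And>\<rho>. \<rho> \<in> hermitian_matrices \<Longrightarrow> (\<lambda>n. \<Phi>s n \<rho>) \<longlonglongrightarrow> \<Phi> \<rho>"
  shows "decomposable \<Phi>"
proof -
  define Q where "Q n A B \<longleftrightarrow> (\<forall>i. A i = 0 \<or> B i = 0) \<and> (\<forall>\<rho>\<in>hermitian_matrices.
      \<Phi>s n \<rho> = (\<Sum>i\<in>UNIV. congruence (A i) \<rho> + congruence (B i) (transpose \<rho>)))"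
    for n and A B :: "4 \<Rightarrow> complex^'n^'n"
  have "\<exists>A B. Q n A B" for n
  proof -
    obtain T :: "4 \<Rightarrow> _" where T: "\<forall>i. elementary (T i)"
      "\<forall>\<rho>\<in>hermitian_matrices. \<Phi>s n \<rho> = (\<Sum>i\<in>UNIV. T i \<rho>)"
      using assms(1)[of n] unfolding decomposable_def by blast
    have "\<forall>i. \<exists>A B. (A = 0 \<or> B = 0) \<and> (\<forall>\<rho>. T i \<rho> = congruence A \<rho> + congruence B (transpose \<rho>))"
      using T(1) unfolding elementary_def by (simp add: fun_eq_iff)
    then obtain A B where "\<And>i. A i = 0 \<or> B i = 0"
      "\<And>i \<rho>. T i \<rho> = congruence (A i) \<rho> + congruence (B i) (transpose \<rho>)"
      unfolding choice_iff by blast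
    then show ?thesis
      using T(2) unfolding Q_def by (intro exI[of _ A] exI[of _ B]) simp
  qed
  then obtain A B where "\<And>n. Q n (A n) (B n)"
    by metis
  then have AB: "\<And>n i. A n i = 0 \<or> B n i = 0"
    and \<Phi>s: "\<And>n \<rho>. \<rho> \<in> hermitian_matrices \<Longrightarrow>
      \<Phi>s n \<rho> = (\<Sum>i\<in>UNIV. congruence (A n i) \<rho> + congruence (B n i) (transpose \<rho>))"
    unfolding Q_def by blast+
  \<comment> \<open>All eight matrices are packed into one vector, so that a single subsequence
    serves them all.\<close>
  define v :: "nat \<Rightarrow> ((complex^'n^'n) \<times> (complex^'n^'n))^4" where "v n = (\<chi> i. (A n i, B n i))" for n
  have norm_v: "(norm (v n))\<^sup>2 = Re (trace (\<Phi>s n (mat 1)))" for n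
  proof -
    have "(norm (v n))\<^sup>2 = (\<Sum>i\<in>UNIV. (norm (A n i))\<^sup>2 + (norm (B n i))\<^sup>2)"
      unfolding power2_norm_eq_inner by (subst inner_vec_def) (simp only: v_def vec_lambda_beta inner_Pair)
    also have "\<dots> = Re (trace (\<Phi>s n (mat 1)))"
      by (simp add: \<Phi>s hermitian_mat_1 trace_sum trace_add transpose_mat sum.distrib
          flip: trace_congruence_mat_1)
    finally show ?thesis .
  qed
  have "(\<lambda>n. Re (trace (\<Phi>s n (mat 1)))) \<longlonglongrightarrow> Re (trace (\<Phi> (mat 1)))"
    unfolding trace_def by (intro tendsto_intros lim hermitian_mat_1)
  then have "Bseq (\<lambda>n. (norm (v n))\<^sup>2)"
    unfolding norm_v using convergentI convergent_imp_Bseq by blast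
  then obtain K where K: "\<And>n. (norm (v n))\<^sup>2 \<le> K"
    by (auto simp: Bseq_def)
  have "bounded (range v)"
    unfolding bounded_iff
  proof (intro exI ballI)
    fix y assume "y \<in> range v"
    then show "norm y \<le> sqrt K"
      using K real_le_rsqrt by blast
  qed
  then obtain l r where r: "strict_mono r" and l: "(v \<circ> r) \<longlonglongrightarrow> l"
    using bounded_imp_convergent_subsequence by blast
  define A' B' where "A' i = fst (l $ i)" and "B' i = snd (l $ i)" for i
  have "(\<lambda>n. v (r n) $ i) \<longlonglongrightarrow> l $ i" for i
    using tendsto_vec_nth[OF l] by (simp add: o_def)
  then have A': "(\<lambda>n. A (r n) i) \<longlonglongrightarrow> A' i" and B': "(\<lambda>n. B (r n) i) \<longlonglongrightarrow> B' i" for i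
    using tendsto_fst[of "\<lambda>n. v (r n) $ i" "l $ i"] tendsto_snd[of "\<lambda>n. v (r n) $ i" "l $ i"]
    by (simp_all add: v_def A'_def B'_def)
  have "A' i = 0 \<or> B' i = 0" for i
  proof -
    \<comment> \<open>The product of the norms expresses the disjunction as an equation, which is
      preserved by limits.\<close>
    have "(\<lambda>n. norm (A (r n) i) * norm (B (r n) i)) \<longlonglongrightarrow> norm (A' i) * norm (B' i)"
      by (intro tendsto_intros A' B')
    moreover have "(\<lambda>n. norm (A (r n) i) * norm (B (r n) i)) = (\<lambda>n. 0)"
      using AB by auto
    ultimately have "norm (A' i) * norm (B' i) = 0"
      using LIMSEQ_unique[OF _ tendsto_const] by metis
    then show ?thesis
      by simp
  qed
  moreover have "\<Phi> \<rho> = (\<Sum>i\<in>UNIV. congruence (A' i) \<rho> + congruence (B' i) (transpose \<rho>))"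
    if \<rho>: "\<rho> \<in> hermitian_matrices" for \<rho>
  proof (rule LIMSEQ_unique)
    show "(\<lambda>n. \<Phi>s (r n) \<rho>) \<longlonglongrightarrow> \<Phi> \<rho>"
      using LIMSEQ_subseq_LIMSEQ[OF lim[OF \<rho>] r] by (simp add: o_def)
    have congruence_lim: "(\<lambda>n. congruence (C n) \<sigma>) \<longlonglongrightarrow> congruence L \<sigma>" if "C \<longlonglongrightarrow> L" for C \<sigma> and L :: "complex^'n^'n"
      using continuous_on_tendsto_compose[OF continuous_on_congruence that, of UNIV] by simp
    show "(\<lambda>n. \<Phi>s (r n) \<rho>) \<longlonglongrightarrow> (\<Sum>i\<in>UNIV. congruence (A' i) \<rho> + congruence (B' i) (transpose \<rho>))"
      unfolding \<Phi>s[OF \<rho>] by (intro tendsto_intros congruence_lim A' B')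
  qed
  ultimately show ?thesis
    unfolding decomposable_def elementary_def
    by (intro exI[of _ "\<lambda>i \<rho>. congruence (A' i) \<rho> + congruence (B' i) (transpose \<rho>)"]) blast
qed

text \<open>Compose \<Phi> with the projection onto the Hermitian part, which is real-linear on all
  matrices.\<close>

lemma linear_on_hermitian_extend:
  fixes \<Phi> :: "complex^'n^'n \<Rightarrow> complex^'n^'n"
  assumes "linear_on_hermitian \<Phi>"
  obtains \<Psi> where "linear \<Psi>" "\<And>\<rho>. \<rho> \<in> hermitian_matrices \<Longrightarrow> \<Psi> \<rho> = \<Phi> \<rho>"
proof -
  define h where "h \<rho> = (1 / 2) *\<^sub>R (\<rho> + dagger \<rho>)" for \<rho> :: "complex^'n^'n"
  have h: "h \<rho> \<in> hermitian_matrices" for \<rho>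
    by (simp add: h_def hermitian_matrices_def dagger_scaleR dagger_add add.commute)
  have h_add: "h (\<rho> + \<sigma>) = h \<rho> + h \<sigma>" and h_scaleR: "h (c *\<^sub>R \<rho>) = c *\<^sub>R h \<rho>" for \<rho> \<sigma> c
    by (simp_all add: h_def dagger_add dagger_scaleR algebra_simps)
  have "linear (\<lambda>\<rho>. \<Phi> (h \<rho>))"
    using assms h by (intro linearI) (simp_all add: linear_on_hermitian_def h_add h_scaleR)
  moreover have "h \<rho> = \<rho>" if "\<rho> \<in> hermitian_matrices" for \<rho>
    using that by (simp add: h_def hermitian_matrices_def flip: scaleR_2)
  ultimately show ?thesis
    using that[of "\<lambda>\<rho>. \<Phi> (h \<rho>)"] by simp
qed

lemma positivity_preserving_imp_decomposable:
  fixes \<Phi> :: "complex^2^2 \<Rightarrow> complex^2^2"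
  assumes "linear_on_hermitian \<Phi>" "positivity_preserving \<Phi>"
  shows "decomposable \<Phi>"
proof -
  obtain \<Psi> where \<Psi>: "linear \<Psi>" "\<And>\<rho>. \<rho> \<in> hermitian_matrices \<Longrightarrow> \<Psi> \<rho> = \<Phi> \<rho>"
    using linear_on_hermitian_extend[OF assms(1)] by blast
  have herm: "\<Psi> \<rho> \<in> hermitian_matrices" if "\<rho> \<in> hermitian_matrices" for \<rho>
    using that assms(1) \<Psi>(2) by (auto simp: linear_on_hermitian_def)
  have pos: "positive_semidefinite (\<Psi> \<rho>)" if "positive_semidefinite \<rho>" for \<rho>
    using that assms(2) \<Psi>(2) by (auto simp: positivity_preserving_def positive_semidefinite_def)
  \<comment> \<open>The perturbation supplies the quartic lower bound, which \<Psi> itself may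
    violate by sending nonzero positive matrices to singular ones.\<close>
  define \<Psi>\<epsilon> where "\<Psi>\<epsilon> \<epsilon> \<rho> = \<Psi> \<rho> + (\<epsilon> * Re (trace \<rho>)) *\<^sub>R mat 1" for \<epsilon> and \<rho> :: "complex^2^2"
  have "decomposable (\<Psi>\<epsilon> \<epsilon>)" if "\<epsilon> > 0" for \<epsilon>
  proof (rule decomposable_of_det_lower_bound)
    show "linear (\<Psi>\<epsilon> \<epsilon>)"
      by (rule linearI)
        (simp_all add: \<Psi>\<epsilon>_def linear_add[OF \<Psi>(1)] linear_cmul[OF \<Psi>(1)] trace_def sum_2 algebra_simps)
    show "\<epsilon>\<^sup>2 > 0"
      using that by simp
    show "\<Psi>\<epsilon> \<epsilon> \<rho> \<in> hermitian_matrices" if "\<rho> \<in> hermitian_matrices" for \<rho>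
      using that by (simp add: \<Psi>\<epsilon>_def hermitian_add hermitian_scaleR hermitian_mat_1 herm)
    have perturbed: "\<exists>s x. norm x \<le> s \<and> \<Psi>\<epsilon> \<epsilon> \<rho> = pauli (s + \<epsilon> * Re (trace \<rho>)) x \<and> 0 \<le> Re (trace \<rho>)"
      if \<rho>: "positive_semidefinite \<rho>" for \<rho>
    proof -
      obtain t y where ty: "\<rho> = pauli t y"
        using \<rho> hermitian_obtain_pauli unfolding positive_semidefinite_def by blast
      have "positive_semidefinite (\<Psi> \<rho>)"
        using \<rho> by (rule pos)
      then obtain s x where sx: "\<Psi> \<rho> = pauli s x"
        using hermitian_obtain_pauli unfolding positive_semidefinite_def by blast
      have "norm y \<le> t" "norm x \<le> s"
        using \<rho> ty sx pos[OF \<rho>] by (simp_all add: psd_pauli)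
      then have "0 \<le> t"
        using norm_ge_zero order_trans by blast
      with \<open>norm x \<le> s\<close> show ?thesis
        by (intro exI[of _ s] exI[of _ x])
           (simp add: \<Psi>\<epsilon>_def sx[unfolded ty] ty mat_1_eq_pauli pauli_scaleR pauli_add)
    qed
    show "positivity_preserving (\<Psi>\<epsilon> \<epsilon>)"
      unfolding positivity_preserving_def
    proof (intro allI impI)
      fix \<rho> :: "complex^2^2"
      assume "positive_semidefinite \<rho>"
      then obtain s x where *: "norm x \<le> s" "\<Psi>\<epsilon> \<epsilon> \<rho> = pauli (s + \<epsilon> * Re (trace \<rho>)) x" "0 \<le> Re (trace \<rho>)"
        using perturbed by blast
      moreover have "0 \<le> \<epsilon> * Re (trace \<rho>)"
        using * \<open>\<epsilon> > 0\<close> by simp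
      ultimately show "positive_semidefinite (\<Psi>\<epsilon> \<epsilon> \<rho>)"
        unfolding *(2) psd_pauli by linarith
    qed
    \<comment> \<open>The perturbation adds \<open>\<epsilon> * (norm A)\<^sup>2\<close> to the
      scalar part \<open>s\<close>. Since \<open>norm x \<le> s\<close>, the determinant is at least
      the square of this increment.\<close>
    show "\<epsilon>\<^sup>2 * norm A ^ 4 \<le> Re (det (\<Psi>\<epsilon> \<epsilon> (congruence A (mat 1))))" for A
    proof -
      have "positive_semidefinite (congruence A (mat 1))"
        by (rule psd_congruence) (simp add: mat_1_eq_pauli psd_pauli)
      then obtain s x where *: "norm x \<le> s"
        "\<Psi>\<epsilon> \<epsilon> (congruence A (mat 1)) = pauli (s + \<epsilon> * (norm A)\<^sup>2) x"
        using perturbed trace_congruence_mat_1 by metis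
      then have s: "s \<ge> 0"
        using norm_ge_zero order_trans by blast
      have "x \<bullet> x \<le> s\<^sup>2"
        using * s by (simp add: norm_le_square)
      moreover have "0 \<le> 2 * s * (\<epsilon> * (norm A)\<^sup>2)"
        using s \<open>\<epsilon> > 0\<close> by simp
      moreover have "(s + \<epsilon> * (norm A)\<^sup>2)\<^sup>2 = s\<^sup>2 + 2 * s * (\<epsilon> * (norm A)\<^sup>2) + \<epsilon>\<^sup>2 * norm A ^ 4"
        by (simp add: power2_eq_square power4_eq_xxxx algebra_simps)
      ultimately show ?thesis
        unfolding * det_pauli Re_complex_of_real by linarith
    qed
  qed
  then have "decomposable (\<Psi>\<epsilon> (1 / real (Suc n)))" for n
    by simp
  moreover have "(\<lambda>n. \<Psi>\<epsilon> (1 / real (Suc n)) \<rho>) \<longlonglongrightarrow> \<Phi> \<rho>" if "\<rho> \<in> hermitian_matrices" for \<rho>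
  proof -
    have "(\<lambda>n. \<Psi> \<rho> + (1 / real (Suc n) * Re (trace \<rho>)) *\<^sub>R mat 1) \<longlonglongrightarrow> \<Psi> \<rho> + (0 * Re (trace \<rho>)) *\<^sub>R mat 1"
      by (intro tendsto_intros LIMSEQ_Suc[OF lim_1_over_n])
    then show ?thesis
      using \<Psi>(2)[OF that] by (simp add: \<Psi>\<epsilon>_def)
  qed
  ultimately show ?thesis
    by (rule decomposable_limit)
qed

theorem theorem1:
  fixes \<Phi> :: "complex^2^2 \<Rightarrow> complex^2^2"
  assumes "linear_on_hermitian \<Phi>"
  shows "(positivity_preserving \<Phi> \<longleftrightarrow> (\<exists>m A n B. represents m A n B \<Phi>)) \<and>
         (positivity_preserving \<Phi> \<longrightarrow> (\<exists>m A n B. represents m A n B \<Phi> \<and> m + n \<le> 4))"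
  using positivity_preserving_imp_decomposable[OF assms] decomposable_imp_represents[of \<Phi>]
    represents_imp_positivity_preserving by blast

end
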